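(* Let $(A,\cdot_A,\{\cdot,\cdot\}_A,d_A)$ and $(B,\cdot_B,\{\cdot,\cdot\}_B,d_B)$ be two $\lambda$-DP (respectively $\lambda$-mDP) algebras. If $(C,f,g)$ and $(D,j,k)$ are $\mathcal{P}$-triples of $A$ and $B$, respectively, then $$T:=(C\otimes D,\ f\otimes j,\ f\otimes k+g\otimes j)$$ is a $\mathcal{P}$-triple of $A\otimes B$, where $(f\otimes j)(a\otimes b)=f(a)\otimes j(b)$ for all $a\in A$, $b\in B$ (and similarly for $f\otimes k$ and $g\otimes j$).
   Context: $\mathbf{k}$ is a field of characteristic $0$, $\lambda\in\mathbf{k}$ is fixed, tensor products are over $\mathbf{k}$. "Algebra" means unital associative $\mathbf{k}$-algebra, and algebra homomorphisms are unital. A $\lambda$-differential algebra is $(A,\cdot,d)$ with $(A,\cdot)$ an algebra and $d:A\to A$ linear such that $d(1_A)=0$ and $d(x\cdot y)=d(x)\cdot y+x\cdot d(y)+\lambda d(x)\cdot d(y)$. A modified $\lambda$-differential algebra is $(A,\cdot,d)$ with $d$ linear such that $d(x\cdot y)=d(x)\cdot y+x\cdot d(y)+\lambda x\cdot y$. A homomorphism of such is an algebra homomorphism commuting with the operators $d$. A $\lambda$-DL algebra is $(A,\{\cdot,\cdot\},d)$ with $(A,\{\cdot,\cdot\})$ a Lie algebra and $d$ linear such that $d\{x,y\}=\{d(x),y\}+\{x,d(y)\}+\lambda\{d(x),d(y)\}$. A $\lambda$-mDL algebra is the same with $d\{x,y\}=\{d(x),y\}+\{x,d(y)\}+\lambda\{x,y\}$.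 A homomorphism of such is a Lie algebra homomorphism commuting with the operators $d$. A $\lambda$-DP (respectively $\lambda$-mDP) algebra is a quadruple $(A,\cdot,\{\cdot,\cdot\},d)$ such that $(A,\cdot,d)$ is a $\lambda$-differential (respectively modified $\lambda$-differential) algebra, $(A,\{\cdot,\cdot\},d)$ is a $\lambda$-DL (respectively $\lambda$-mDL) algebra, and $\{a,b\cdot c\}=\{a,b\}\cdot c+b\cdot\{a,c\}$ for all $a,b,c\in A$. Tensor products: $A\otimes B$ carries the product $(a\otimes b)(a'\otimes b')=aa'\otimes bb'$, the bracket $\{a\otimes b,a'\otimes b'\}=aa'\otimes\{b,b'\}_B+\{a,a'\}_A\otimes bb'$, and the operator $d(a\otimes b)=d_A(a)\otimes b+a\otimes d_B(b)+\lambda d_A(a)\otimes d_B(b)$ in the $\lambda$-DP case, respectively $d(a\otimes b)=d_A(a)\otimes b+a\otimes d_B(b)+\lambda a\otimes b$ in the $\lambda$-mDP case. $C\otimes D$ carries the product and operator given by the same formulas. A $\mathcal{P}$-triple of a $\lambda$-DP (respectively $\lambda$-mDP) algebra $A$ is a triple $(B,f,g)$ such that: (P1) $(B,\cdot_B,d_B)$ is a commutative $\lambda$-differential (respectively modified $\lambda$-differential) algebra and $f:(A,\cdot_A,d_A)\to(B,\cdot_B,d_B)$ is a $\lambda$-differential (respectively modified $\lambda$-differential) algebra homomorphism; (P2) $g:(A,\{\cdot,\cdot\}_A,d_A)\to(B,\{\cdot,\cdot\}_B,d_B)$ is a $\lambda$-DL (respectively $\lambda$-mDL) algebra homomorphism,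 where $\{x,y\}_B=x\cdot_By-y\cdot_Bx$; (P3) $f(\{a,b\}_A)=g(a)\cdot_Bf(b)-f(b)\cdot_Bg(a)$; (P4) $g(a\cdot_Ab)=f(a)\cdot_Bg(b)+f(b)\cdot_Bg(a)$, for all $a,b\in A$. *)

theory Defs
  imports "HOL-Algebra.Module" "HOL-Algebra.AbelCoset"
begin

section \<open>Algebras and Lie algebras over a field\<close>

locale field_char_zero = field K for K (structure) +
  assumes char_zero: "\<And>n::nat. n > 0 \<Longrightarrow> [n] \<cdot> \<one> \<noteq> \<zero>"

definition linear_maps ::
  "('k, 'r) ring_scheme \<Rightarrow> ('k, 'a, 'm) module_scheme \<Rightarrow> ('k, 'b, 'n) module_scheme \<Rightarrow> ('a \<Rightarrow> 'b) set"
  where "linear_maps K M N = {h. h \<in> carrier M \<rightarrow> carrier N \<and>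
    (\<forall>x\<in>carrier M. \<forall>y\<in>carrier M. h (x \<oplus>\<^bsub>M\<^esub> y) = h x \<oplus>\<^bsub>N\<^esub> h y) \<and>
    (\<forall>c\<in>carrier K. \<forall>x\<in>carrier M. h (c \<odot>\<^bsub>M\<^esub> x) = c \<odot>\<^bsub>N\<^esub> h x)}"

text \<open>Unital associative algebras; unlike the library locale \<^locale>\<open>algebra\<close>, commutativity of the
  product is not required. The zero algebra is allowed.\<close>

locale assoc_algebra = module K A + ring A
  for K :: "('k, 'r) ring_scheme" and A :: "('k, 'a, 'm) module_scheme" (structure) +
  assumes smult_mult_left:
      "\<lbrakk>c \<in> carrier K; x \<in> carrier A; y \<in> carrier A\<rbrakk> \<Longrightarrow> (c \<odot> x) \<otimes> y = c \<odot> (x \<otimes> y)"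
    and smult_mult_right:
      "\<lbrakk>c \<in> carrier K; x \<in> carrier A; y \<in> carrier A\<rbrakk> \<Longrightarrow> x \<otimes> (c \<odot> y) = c \<odot> (x \<otimes> y)"

locale lie_algebra = module K L
  for K :: "('k, 'r) ring_scheme" and L :: "('k, 'a, 'm) module_scheme" (structure) +
  fixes br :: "'a \<Rightarrow> 'a \<Rightarrow> 'a"
  assumes br_closed: "\<lbrakk>x \<in> carrier L; y \<in> carrier L\<rbrakk> \<Longrightarrow> br x y \<in> carrier L"
    and br_add_left: "\<lbrakk>x \<in> carrier L; y \<in> carrier L; z \<in> carrier L\<rbrakk>
      \<Longrightarrow> br (x \<oplus> y) z = br x z \<oplus> br y z"
    and br_add_right: "\<lbrakk>x \<in> carrier L; y \<in> carrier L; z \<in> carrier L\<rbrakk>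
      \<Longrightarrow> br x (y \<oplus> z) = br x y \<oplus> br x z"
    and br_smult_left: "\<lbrakk>c \<in> carrier K; x \<in> carrier L; y \<in> carrier L\<rbrakk>
      \<Longrightarrow> br (c \<odot> x) y = c \<odot> br x y"
    and br_smult_right: "\<lbrakk>c \<in> carrier K; x \<in> carrier L; y \<in> carrier L\<rbrakk>
      \<Longrightarrow> br x (c \<odot> y) = c \<odot> br x y"
    and br_alternating: "x \<in> carrier L \<Longrightarrow> br x x = \<zero>"
    and br_jacobi: "\<lbrakk>x \<in> carrier L; y \<in> carrier L; z \<in> carrier L\<rbrakk>
      \<Longrightarrow> br x (br y z) \<oplus> br y (br z x) \<oplus> br z (br x y) = \<zero>"

section \<open>Differential and modified differential structures\<close>

record ('k, 'a) diff_alg = "('k, 'a) module" +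
  der :: "'a \<Rightarrow> 'a"

record ('k, 'a) poisson_alg = "('k, 'a) diff_alg" +
  bracket :: "'a \<Rightarrow> 'a \<Rightarrow> 'a"

definition differential_algebra ::
  "('k, 'r) ring_scheme \<Rightarrow> 'k \<Rightarrow> ('k, 'a, 'm) diff_alg_scheme \<Rightarrow> bool"
  where "differential_algebra K l A \<longleftrightarrow> assoc_algebra K A \<and> der A \<in> linear_maps K A A \<and>
    der A \<one>\<^bsub>A\<^esub> = \<zero>\<^bsub>A\<^esub> \<and>
    (\<forall>x\<in>carrier A. \<forall>y\<in>carrier A. der A (x \<otimes>\<^bsub>A\<^esub> y) =
      der A x \<otimes>\<^bsub>A\<^esub> y \<oplus>\<^bsub>A\<^esub> x \<otimes>\<^bsub>A\<^esub> der A y \<oplus>\<^bsub>A\<^esub> l \<odot>\<^bsub>A\<^esub> (der A x \<otimes>\<^bsub>A\<^esub> der A y))"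

definition mdifferential_algebra ::
  "('k, 'r) ring_scheme \<Rightarrow> 'k \<Rightarrow> ('k, 'a, 'm) diff_alg_scheme \<Rightarrow> bool"
  where "mdifferential_algebra K l A \<longleftrightarrow> assoc_algebra K A \<and> der A \<in> linear_maps K A A \<and>
    (\<forall>x\<in>carrier A. \<forall>y\<in>carrier A. der A (x \<otimes>\<^bsub>A\<^esub> y) =
      der A x \<otimes>\<^bsub>A\<^esub> y \<oplus>\<^bsub>A\<^esub> x \<otimes>\<^bsub>A\<^esub> der A y \<oplus>\<^bsub>A\<^esub> l \<odot>\<^bsub>A\<^esub> (x \<otimes>\<^bsub>A\<^esub> y))"

definition DL_algebra ::
  "('k, 'r) ring_scheme \<Rightarrow> 'k \<Rightarrow> ('k, 'a, 'm) module_scheme \<Rightarrow> ('a \<Rightarrow> 'a \<Rightarrow> 'a) \<Rightarrow> ('a \<Rightarrow> 'a) \<Rightarrow> bool"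
  where "DL_algebra K l L br d \<longleftrightarrow> lie_algebra K L br \<and> d \<in> linear_maps K L L \<and>
    (\<forall>x\<in>carrier L. \<forall>y\<in>carrier L. d (br x y) =
      br (d x) y \<oplus>\<^bsub>L\<^esub> br x (d y) \<oplus>\<^bsub>L\<^esub> l \<odot>\<^bsub>L\<^esub> br (d x) (d y))"

definition mDL_algebra ::
  "('k, 'r) ring_scheme \<Rightarrow> 'k \<Rightarrow> ('k, 'a, 'm) module_scheme \<Rightarrow> ('a \<Rightarrow> 'a \<Rightarrow> 'a) \<Rightarrow> ('a \<Rightarrow> 'a) \<Rightarrow> bool"
  where "mDL_algebra K l L br d \<longleftrightarrow> lie_algebra K L br \<and> d \<in> linear_maps K L L \<and>
    (\<forall>x\<in>carrier L. \<forall>y\<in>carrier L. d (br x y) =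
      br (d x) y \<oplus>\<^bsub>L\<^esub> br x (d y) \<oplus>\<^bsub>L\<^esub> l \<odot>\<^bsub>L\<^esub> br x y)"

definition poisson_rule :: "('k, 'a, 'm) poisson_alg_scheme \<Rightarrow> bool"
  where "poisson_rule A \<longleftrightarrow> (\<forall>a\<in>carrier A. \<forall>b\<in>carrier A. \<forall>c\<in>carrier A.
    bracket A a (b \<otimes>\<^bsub>A\<^esub> c) = bracket A a b \<otimes>\<^bsub>A\<^esub> c \<oplus>\<^bsub>A\<^esub> b \<otimes>\<^bsub>A\<^esub> bracket A a c)"

definition DP_algebra ::
  "('k, 'r) ring_scheme \<Rightarrow> 'k \<Rightarrow> ('k, 'a, 'm) poisson_alg_scheme \<Rightarrow> bool"
  where "DP_algebra K l A \<longleftrightarrow>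
    differential_algebra K l A \<and> DL_algebra K l A (bracket A) (der A) \<and> poisson_rule A"

definition mDP_algebra ::
  "('k, 'r) ring_scheme \<Rightarrow> 'k \<Rightarrow> ('k, 'a, 'm) poisson_alg_scheme \<Rightarrow> bool"
  where "mDP_algebra K l A \<longleftrightarrow>
    mdifferential_algebra K l A \<and> mDL_algebra K l A (bracket A) (der A) \<and> poisson_rule A"

section \<open>Homomorphisms and P-triples\<close>

definition algebra_homs ::
  "('k, 'r) ring_scheme \<Rightarrow> ('k, 'a, 'm) module_scheme \<Rightarrow> ('k, 'b, 'n) module_scheme \<Rightarrow> ('a \<Rightarrow> 'b) set"
  where "algebra_homs K A B = ring_hom A B \<inter> linear_maps K A B"

definition lie_homs ::
  "('k, 'r) ring_scheme \<Rightarrow> ('k, 'a, 'm) module_scheme \<Rightarrow> ('a \<Rightarrow> 'a \<Rightarrow> 'a) \<Rightarrow>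
   ('k, 'b, 'n) module_scheme \<Rightarrow> ('b \<Rightarrow> 'b \<Rightarrow> 'b) \<Rightarrow> ('a \<Rightarrow> 'b) set"
  where "lie_homs K L br L' br' = {h \<in> linear_maps K L L'.
    \<forall>x\<in>carrier L. \<forall>y\<in>carrier L. h (br x y) = br' (h x) (h y)}"

definition commutes_with_der ::
  "('k, 'a, 'm) diff_alg_scheme \<Rightarrow> ('k, 'b, 'n) diff_alg_scheme \<Rightarrow> ('a \<Rightarrow> 'b) \<Rightarrow> bool"
  where "commutes_with_der A B h \<longleftrightarrow> (\<forall>x\<in>carrier A. h (der A x) = der B (h x))"

definition commutator :: "('a, 'm) ring_scheme \<Rightarrow> 'a \<Rightarrow> 'a \<Rightarrow> 'a"
  where "commutator B x y = x \<otimes>\<^bsub>B\<^esub> y \<ominus>\<^bsub>B\<^esub> y \<otimes>\<^bsub>B\<^esub> x"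

definition commutative_mult :: "('a, 'm) ring_scheme \<Rightarrow> bool"
  where "commutative_mult B \<longleftrightarrow> (\<forall>x\<in>carrier B. \<forall>y\<in>carrier B. x \<otimes>\<^bsub>B\<^esub> y = y \<otimes>\<^bsub>B\<^esub> x)"

text \<open>Homomorphisms are conditions on the map alone, so the P-triple conditions make sense for
  every quadruple \<open>(A, \<cdot>, {\<cdot>,\<cdot>}, d)\<close>. This matters for tensor products: the products of (m)DP
  algebras need not commute, and then the bracket on \<open>A \<otimes> B\<close> need not be a Lie bracket (take the
  commutator brackets on two matrix algebras). The commutator bracket of a (modified) differential
  algebra always makes it a DL (mDL) algebra, so this is not required separately.\<close>

definition ptriple_lie :: "('k, 'r) ring_scheme \<Rightarrow> ('k, 'a, 'm) poisson_alg_scheme \<Rightarrow>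
    ('k, 'b, 'n) diff_alg_scheme \<Rightarrow> ('a \<Rightarrow> 'b) \<Rightarrow> bool"
  where "ptriple_lie K A B g \<longleftrightarrow> g \<in> lie_homs K A (bracket A) B (commutator B) \<and> commutes_with_der A B g"

definition ptriple_bracket :: "('k, 'a, 'm) poisson_alg_scheme \<Rightarrow> ('k, 'b, 'n) diff_alg_scheme \<Rightarrow>
    ('a \<Rightarrow> 'b) \<Rightarrow> ('a \<Rightarrow> 'b) \<Rightarrow> bool"
  where "ptriple_bracket A B f g \<longleftrightarrow> (\<forall>a\<in>carrier A. \<forall>b\<in>carrier A.
    f (bracket A a b) = g a \<otimes>\<^bsub>B\<^esub> f b \<ominus>\<^bsub>B\<^esub> f b \<otimes>\<^bsub>B\<^esub> g a)"

definition ptriple_mult :: "('k, 'a, 'm) poisson_alg_scheme \<Rightarrow> ('k, 'b, 'n) diff_alg_scheme \<Rightarrow>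
    ('a \<Rightarrow> 'b) \<Rightarrow> ('a \<Rightarrow> 'b) \<Rightarrow> bool"
  where "ptriple_mult A B f g \<longleftrightarrow> (\<forall>a\<in>carrier A. \<forall>b\<in>carrier A.
    g (a \<otimes>\<^bsub>A\<^esub> b) = f a \<otimes>\<^bsub>B\<^esub> g b \<oplus>\<^bsub>B\<^esub> f b \<otimes>\<^bsub>B\<^esub> g a)"

definition DP_triple :: "('k, 'r) ring_scheme \<Rightarrow> 'k \<Rightarrow> ('k, 'a, 'm) poisson_alg_scheme \<Rightarrow>
    ('k, 'b, 'n) diff_alg_scheme \<Rightarrow> ('a \<Rightarrow> 'b) \<Rightarrow> ('a \<Rightarrow> 'b) \<Rightarrow> bool"
  where "DP_triple K l A B f g \<longleftrightarrow>
    (differential_algebra K l B \<and> commutative_mult B \<and>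
      f \<in> algebra_homs K A B \<and> commutes_with_der A B f) \<and>
    ptriple_lie K A B g \<and> ptriple_bracket A B f g \<and> ptriple_mult A B f g"

definition mDP_triple :: "('k, 'r) ring_scheme \<Rightarrow> 'k \<Rightarrow> ('k, 'a, 'm) poisson_alg_scheme \<Rightarrow>
    ('k, 'b, 'n) diff_alg_scheme \<Rightarrow> ('a \<Rightarrow> 'b) \<Rightarrow> ('a \<Rightarrow> 'b) \<Rightarrow> bool"
  where "mDP_triple K l A B f g \<longleftrightarrow>
    (mdifferential_algebra K l B \<and> commutative_mult B \<and>
      f \<in> algebra_homs K A B \<and> commutes_with_der A B f) \<and>
    ptriple_lie K A B g \<and> ptriple_bracket A B f g \<and> ptriple_mult A B f g"

section \<open>Tensor products over K\<close>

text \<open>The tensor product of modules is the quotient of the free module on \<open>carrier A \<times> carrier B\<close>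
  (finitely supported functions) by the submodule generated by the bilinearity relations. The
  multiplicative fields of the records \<open>free_module\<close> and \<open>tensor_module\<close> are meaningless.\<close>

definition free_module :: "('k, 'r) ring_scheme \<Rightarrow> 'x set \<Rightarrow> ('k, 'x \<Rightarrow> 'k) module"
  where "free_module K S = \<lparr>
    carrier = {\<phi>. (\<forall>x. \<phi> x \<in> carrier K) \<and> {x. \<phi> x \<noteq> \<zero>\<^bsub>K\<^esub>} \<subseteq> S \<and> finite {x. \<phi> x \<noteq> \<zero>\<^bsub>K\<^esub>}},
    mult = undefined, one = undefined,
    zero = (\<lambda>_. \<zero>\<^bsub>K\<^esub>),
    add = (\<lambda>\<phi> \<psi> x. \<phi> x \<oplus>\<^bsub>K\<^esub> \<psi> x),
    smult = (\<lambda>c \<phi> x. c \<otimes>\<^bsub>K\<^esub> \<phi> x)\<rparr>"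

definition free_gen :: "('k, 'r) ring_scheme \<Rightarrow> 'x \<Rightarrow> 'x \<Rightarrow> 'k"
  where "free_gen K x = (\<lambda>y. if y = x then \<one>\<^bsub>K\<^esub> else \<zero>\<^bsub>K\<^esub>)"

abbreviation free_on_pairs :: "('k, 'r) ring_scheme \<Rightarrow> ('k, 'a, 'm) module_scheme \<Rightarrow>
    ('k, 'b, 'n) module_scheme \<Rightarrow> ('k, 'a \<times> 'b \<Rightarrow> 'k) module"
  where "free_on_pairs K A B \<equiv> free_module K (carrier A \<times> carrier B)"

definition bilinear_relations :: "('k, 'r) ring_scheme \<Rightarrow> ('k, 'a, 'm) module_scheme \<Rightarrow>
    ('k, 'b, 'n) module_scheme \<Rightarrow> ('a \<times> 'b \<Rightarrow> 'k) set"
  where "bilinear_relations K A B = (let F = free_on_pairs K A B; e = (\<lambda>a b. free_gen K (a, b)) in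
    {e (a \<oplus>\<^bsub>A\<^esub> a') b \<ominus>\<^bsub>F\<^esub> (e a b \<oplus>\<^bsub>F\<^esub> e a' b) | a a' b. a \<in> carrier A \<and> a' \<in> carrier A \<and> b \<in> carrier B} \<union>
    {e a (b \<oplus>\<^bsub>B\<^esub> b') \<ominus>\<^bsub>F\<^esub> (e a b \<oplus>\<^bsub>F\<^esub> e a b') | a b b'. a \<in> carrier A \<and> b \<in> carrier B \<and> b' \<in> carrier B} \<union>
    {e (c \<odot>\<^bsub>A\<^esub> a) b \<ominus>\<^bsub>F\<^esub> c \<odot>\<^bsub>F\<^esub> e a b | c a b. c \<in> carrier K \<and> a \<in> carrier A \<and> b \<in> carrier B} \<union>
    {e a (c \<odot>\<^bsub>B\<^esub> b) \<ominus>\<^bsub>F\<^esub> c \<odot>\<^bsub>F\<^esub> e a b | c a b. c \<in> carrier K \<and> a \<in> carrier A \<and> b \<in> carrier B})"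

definition tensor_null :: "('k, 'r) ring_scheme \<Rightarrow> ('k, 'a, 'm) module_scheme \<Rightarrow>
    ('k, 'b, 'n) module_scheme \<Rightarrow> ('a \<times> 'b \<Rightarrow> 'k) set"
  where "tensor_null K A B =
    \<Inter>{N. submodule N K (free_on_pairs K A B) \<and> bilinear_relations K A B \<subseteq> N}"

definition tensor_module :: "('k, 'r) ring_scheme \<Rightarrow> ('k, 'a, 'm) module_scheme \<Rightarrow>
    ('k, 'b, 'n) module_scheme \<Rightarrow> ('k, ('a \<times> 'b \<Rightarrow> 'k) set) module"
  where "tensor_module K A B = (let F = free_on_pairs K A B; N = tensor_null K A B in \<lparr>
    carrier = a_rcosets\<^bsub>F\<^esub> N,
    mult = undefined, one = undefined,
    zero = N,
    add = (\<lambda>U V. U <+>\<^bsub>F\<^esub> V),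
    smult = (\<lambda>c U. N <+>\<^bsub>F\<^esub> ((\<lambda>\<phi>. c \<odot>\<^bsub>F\<^esub> \<phi>) ` U))\<rparr>)"

definition pure_tensor :: "('k, 'r) ring_scheme \<Rightarrow> ('k, 'a, 'm) module_scheme \<Rightarrow>
    ('k, 'b, 'n) module_scheme \<Rightarrow> 'a \<Rightarrow> 'b \<Rightarrow> ('a \<times> 'b \<Rightarrow> 'k) set"
  where "pure_tensor K A B a b = tensor_null K A B +>\<^bsub>free_on_pairs K A B\<^esub> free_gen K (a, b)"

text \<open>The linear map out of a tensor product induced by a bilinear map \<open>h\<close> into \<open>M\<close>: for bilinear \<open>h\<close>
  the value \<open>\<Sum>\<phi>(a,b) h(a,b)\<close> does not depend on the representative \<open>\<phi>\<close> of the class \<open>U\<close>. All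
  maps and operations given on pure tensors are extended in this way.\<close>

definition tensor_lift :: "('k, 'r) ring_scheme \<Rightarrow> ('k, 'c, 'm) module_scheme \<Rightarrow>
    ('a \<Rightarrow> 'b \<Rightarrow> 'c) \<Rightarrow> ('a \<times> 'b \<Rightarrow> 'k) set \<Rightarrow> 'c"
  where "tensor_lift K M h U = the_elem
    ((\<lambda>\<phi>. \<Oplus>\<^bsub>M\<^esub>p\<in>{p. \<phi> p \<noteq> \<zero>\<^bsub>K\<^esub>}. \<phi> p \<odot>\<^bsub>M\<^esub> h (fst p) (snd p)) ` U)"

definition tensor_map :: "('k, 'r) ring_scheme \<Rightarrow> ('k, 'c, 'm) module_scheme \<Rightarrow>
    ('k, 'd, 'n) module_scheme \<Rightarrow> ('a \<Rightarrow> 'c) \<Rightarrow> ('b \<Rightarrow> 'd) \<Rightarrow>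
    ('a \<times> 'b \<Rightarrow> 'k) set \<Rightarrow> ('c \<times> 'd \<Rightarrow> 'k) set"
  where "tensor_map K C D f j =
    tensor_lift K (tensor_module K C D) (\<lambda>a b. pure_tensor K C D (f a) (j b))"

definition tensor_mult :: "('k, 'r) ring_scheme \<Rightarrow> ('k, 'a, 'm) module_scheme \<Rightarrow>
    ('k, 'b, 'n) module_scheme \<Rightarrow>
    ('a \<times> 'b \<Rightarrow> 'k) set \<Rightarrow> ('a \<times> 'b \<Rightarrow> 'k) set \<Rightarrow> ('a \<times> 'b \<Rightarrow> 'k) set"
  where "tensor_mult K A B U V =
    tensor_lift K (tensor_module K A B) (\<lambda>a b.
      tensor_lift K (tensor_module K A B) (\<lambda>a' b'.
        pure_tensor K A B (a \<otimes>\<^bsub>A\<^esub> a') (b \<otimes>\<^bsub>B\<^esub> b')) V) U"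

definition tensor_bracket :: "('k, 'r) ring_scheme \<Rightarrow> ('k, 'a, 'm) poisson_alg_scheme \<Rightarrow>
    ('k, 'b, 'n) poisson_alg_scheme \<Rightarrow>
    ('a \<times> 'b \<Rightarrow> 'k) set \<Rightarrow> ('a \<times> 'b \<Rightarrow> 'k) set \<Rightarrow> ('a \<times> 'b \<Rightarrow> 'k) set"
  where "tensor_bracket K A B U V =
    tensor_lift K (tensor_module K A B) (\<lambda>a b.
      tensor_lift K (tensor_module K A B) (\<lambda>a' b'.
        pure_tensor K A B (a \<otimes>\<^bsub>A\<^esub> a') (bracket B b b') \<oplus>\<^bsub>tensor_module K A B\<^esub>
        pure_tensor K A B (bracket A a a') (b \<otimes>\<^bsub>B\<^esub> b')) V) U"

definition tensor_der :: "('k, 'r) ring_scheme \<Rightarrow> 'k \<Rightarrow> ('k, 'a, 'm) diff_alg_scheme \<Rightarrow>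
    ('k, 'b, 'n) diff_alg_scheme \<Rightarrow> ('a \<times> 'b \<Rightarrow> 'k) set \<Rightarrow> ('a \<times> 'b \<Rightarrow> 'k) set"
  where "tensor_der K l A B = (let T = tensor_module K A B in tensor_lift K T (\<lambda>a b.
    pure_tensor K A B (der A a) b \<oplus>\<^bsub>T\<^esub> pure_tensor K A B a (der B b) \<oplus>\<^bsub>T\<^esub>
    l \<odot>\<^bsub>T\<^esub> pure_tensor K A B (der A a) (der B b)))"

definition tensor_mder :: "('k, 'r) ring_scheme \<Rightarrow> 'k \<Rightarrow> ('k, 'a, 'm) diff_alg_scheme \<Rightarrow>
    ('k, 'b, 'n) diff_alg_scheme \<Rightarrow> ('a \<times> 'b \<Rightarrow> 'k) set \<Rightarrow> ('a \<times> 'b \<Rightarrow> 'k) set"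
  where "tensor_mder K l A B = (let T = tensor_module K A B in tensor_lift K T (\<lambda>a b.
    pure_tensor K A B (der A a) b \<oplus>\<^bsub>T\<^esub> pure_tensor K A B a (der B b) \<oplus>\<^bsub>T\<^esub>
    l \<odot>\<^bsub>T\<^esub> pure_tensor K A B a b))"

definition tensor_algebra :: "('k, 'r) ring_scheme \<Rightarrow> ('k, 'a, 'm) module_scheme \<Rightarrow>
    ('k, 'b, 'n) module_scheme \<Rightarrow> ('k, ('a \<times> 'b \<Rightarrow> 'k) set) module"
  where "tensor_algebra K A B = (tensor_module K A B)
    \<lparr>mult := tensor_mult K A B, one := pure_tensor K A B \<one>\<^bsub>A\<^esub> \<one>\<^bsub>B\<^esub>\<rparr>"

definition diff_tensor :: "('k, 'r) ring_scheme \<Rightarrow> 'k \<Rightarrow> ('k, 'a, 'm) diff_alg_scheme \<Rightarrow>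
    ('k, 'b, 'n) diff_alg_scheme \<Rightarrow> ('k, ('a \<times> 'b \<Rightarrow> 'k) set) diff_alg"
  where "diff_tensor K l A B =
    module.extend (tensor_algebra K A B) \<lparr>der = tensor_der K l A B\<rparr>"

definition mdiff_tensor :: "('k, 'r) ring_scheme \<Rightarrow> 'k \<Rightarrow> ('k, 'a, 'm) diff_alg_scheme \<Rightarrow>
    ('k, 'b, 'n) diff_alg_scheme \<Rightarrow> ('k, ('a \<times> 'b \<Rightarrow> 'k) set) diff_alg"
  where "mdiff_tensor K l A B =
    module.extend (tensor_algebra K A B) \<lparr>der = tensor_mder K l A B\<rparr>"

definition DP_tensor :: "('k, 'r) ring_scheme \<Rightarrow> 'k \<Rightarrow> ('k, 'a, 'm) poisson_alg_scheme \<Rightarrow>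
    ('k, 'b, 'n) poisson_alg_scheme \<Rightarrow> ('k, ('a \<times> 'b \<Rightarrow> 'k) set) poisson_alg"
  where "DP_tensor K l A B =
    diff_alg.extend (diff_tensor K l A B) \<lparr>bracket = tensor_bracket K A B\<rparr>"

definition mDP_tensor :: "('k, 'r) ring_scheme \<Rightarrow> 'k \<Rightarrow> ('k, 'a, 'm) poisson_alg_scheme \<Rightarrow>
    ('k, 'b, 'n) poisson_alg_scheme \<Rightarrow> ('k, ('a \<times> 'b \<Rightarrow> 'k) set) poisson_alg"
  where "mDP_tensor K l A B =
    diff_alg.extend (mdiff_tensor K l A B) \<lparr>bracket = tensor_bracket K A B\<rparr>"

end

theory Submission
  imports Defs
begin

text \<open>All maps and operations on a tensor product are determined by their (bi)linearity and their values
  on pure tensors, so every identity is checked on pure tensors. The algebra \<open>C\<close> of a P-triple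
  \<open>(C, f, g)\<close> is commutative, so its commutator bracket vanishes and (P2), (P3) say that \<open>g\<close> and \<open>f\<close>
  kill all brackets. The same then holds for \<open>f \<otimes> j\<close> and \<open>f \<otimes> k + g \<otimes> j\<close>, because
  \<open>{a \<otimes> b, a' \<otimes> b'}\<close> has a bracket in one factor of each of its two summands. What remains are the
  Leibniz rule on \<open>C \<otimes> D\<close>, the compatibility with the operators, and (P4).\<close>

section \<open>Linear and bilinear maps\<close>

text \<open>A value of \<open>tensor_lift\<close> is a \<open>the_elem\<close>, which says nothing
  until the sum over a representative is known to be constant on each coset. The universal property
  therefore has to be in place before anything can be evaluated on a pure tensor. Products and
  brackets are a lift nested in a lift: the inner lift must itself be shown bilinear in the outer
  pair before the outer lift means anything. The two cases of the theorem differ only in the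
  operator. Everything that does not mention the operator is proved once, for any record whose
  underlying algebra is the tensor algebra; only the Leibniz rule and the compatibility with the
  operators are done twice.\<close>

definition bilinear_maps ::
  "('k, 'r) ring_scheme \<Rightarrow> ('k, 'a, 'm) module_scheme \<Rightarrow> ('k, 'b, 'n) module_scheme \<Rightarrow>
   ('k, 'c, 'p) module_scheme \<Rightarrow> ('a \<Rightarrow> 'b \<Rightarrow> 'c) set"
  where "bilinear_maps K A B M = {h. (\<forall>a\<in>carrier A. h a \<in> linear_maps K B M) \<and>
    (\<forall>b\<in>carrier B. (\<lambda>a. h a b) \<in> linear_maps K A M)}"

lemma linear_mapsI:
  assumes "\<And>x. x \<in> carrier M \<Longrightarrow> h x \<in> carrier N"
    and "\<And>x y. \<lbrakk>x \<in> carrier M; y \<in> carrier M\<rbrakk> \<Longrightarrow> h (x \<oplus>\<^bsub>M\<^esub> y) = h x \<oplus>\<^bsub>N\<^esub> h y"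
    and "\<And>c x. \<lbrakk>c \<in> carrier K; x \<in> carrier M\<rbrakk> \<Longrightarrow> h (c \<odot>\<^bsub>M\<^esub> x) = c \<odot>\<^bsub>N\<^esub> h x"
  shows "h \<in> linear_maps K M N"
  using assms by (auto simp: linear_maps_def)

lemma linear_mapsD:
  assumes "h \<in> linear_maps K M N"
  shows linear_maps_closed: "x \<in> carrier M \<Longrightarrow> h x \<in> carrier N"
    and linear_maps_add: "\<lbrakk>x \<in> carrier M; y \<in> carrier M\<rbrakk> \<Longrightarrow> h (x \<oplus>\<^bsub>M\<^esub> y) = h x \<oplus>\<^bsub>N\<^esub> h y"
    and linear_maps_smult: "\<lbrakk>c \<in> carrier K; x \<in> carrier M\<rbrakk> \<Longrightarrow> h (c \<odot>\<^bsub>M\<^esub> x) = c \<odot>\<^bsub>N\<^esub> h x"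
  using assms by (auto simp: linear_maps_def)

text \<open>Tensor products occur both as bare modules and inside larger records with product,
  operator or bracket. Linearity sees only carrier, addition and scalars, so facts about the bare
  module transfer.\<close>

lemma linear_maps_cong:
  assumes "carrier M = carrier M'" "add M = add M'" "smult M = smult M'"
    and "carrier N = carrier N'" "add N = add N'" "smult N = smult N'"
  shows "linear_maps K M N = linear_maps K M' N'"
  using assms by (simp add: linear_maps_def)

lemma linear_maps_id: "(\<lambda>x. x) \<in> linear_maps K M M"
  by (intro linear_mapsI refl)

lemma linear_maps_comp:
  assumes "h \<in> linear_maps K M N" "u \<in> linear_maps K N P"
  shows "(\<lambda>x. u (h x)) \<in> linear_maps K M P"
  using linear_mapsD[OF assms(1)] linear_mapsD[OF assms(2)] by (intro linear_mapsI) simp_all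

lemma linear_maps_sum:
  assumes "module K N" "h \<in> linear_maps K M N" "u \<in> linear_maps K M N"
  shows "(\<lambda>x. h x \<oplus>\<^bsub>N\<^esub> u x) \<in> linear_maps K M N"
proof -
  interpret N: module K N by fact
  show ?thesis
    using linear_mapsD[OF assms(2)] linear_mapsD[OF assms(3)]
    by (intro linear_mapsI) (simp_all add: N.M.a_ac N.smult_r_distr)
qed

lemma linear_maps_scale:
  assumes "module K N" "h \<in> linear_maps K M N" "c \<in> carrier K"
  shows "(\<lambda>x. c \<odot>\<^bsub>N\<^esub> h x) \<in> linear_maps K M N"
proof -
  interpret N: module K N by fact
  show ?thesis
    using linear_mapsD[OF assms(2)] assms(3)
    by (intro linear_mapsI)
      (simp_all add: N.smult_r_distr flip: N.smult_assoc1, simp add: N.R.m_comm)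
qed

lemma linear_maps_zero:
  assumes "module K M" "module K N" "h \<in> linear_maps K M N"
  shows "h \<zero>\<^bsub>M\<^esub> = \<zero>\<^bsub>N\<^esub>"
proof -
  interpret M: module K M by fact
  interpret N: module K N by fact
  have "h (\<zero>\<^bsub>K\<^esub> \<odot>\<^bsub>M\<^esub> \<zero>\<^bsub>M\<^esub>) = \<zero>\<^bsub>K\<^esub> \<odot>\<^bsub>N\<^esub> h \<zero>\<^bsub>M\<^esub>"
    by (rule linear_maps_smult[OF assms(3)]) simp_all
  then show ?thesis
    using linear_maps_closed[OF assms(3), of "\<zero>\<^bsub>M\<^esub>"] by simp
qed

lemma linear_maps_minus:
  assumes "module K M" "module K N" "h \<in> linear_maps K M N" "x \<in> carrier M"
  shows "h (\<ominus>\<^bsub>M\<^esub> x) = \<ominus>\<^bsub>N\<^esub> h x"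
proof -
  interpret M: module K M by fact
  interpret N: module K N by fact
  have "h (\<ominus>\<^bsub>M\<^esub> x) \<oplus>\<^bsub>N\<^esub> h x = \<zero>\<^bsub>N\<^esub>"
    using linear_maps_add[OF assms(3), of "\<ominus>\<^bsub>M\<^esub> x" x] linear_maps_zero[OF assms(1-3)] assms(4)
    by (simp add: M.M.l_neg)
  then show ?thesis
    using linear_maps_closed[OF assms(3)] assms(4) by (simp add: N.M.minus_equality)
qed

text \<open>The bilinearity relations are differences; this turns their vanishing under a linear map
  into equations.\<close>

lemma linear_maps_diff_eq_zero_iff:
  assumes "module K M" "module K N" "h \<in> linear_maps K M N" "x \<in> carrier M" "y \<in> carrier M"
  shows "h (x \<ominus>\<^bsub>M\<^esub> y) = \<zero>\<^bsub>N\<^esub> \<longleftrightarrow> h x = h y"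
proof -
  interpret M: module K M by fact
  interpret N: module K N by fact
  have "h (x \<ominus>\<^bsub>M\<^esub> y) = h x \<ominus>\<^bsub>N\<^esub> h y"
    using assms linear_maps_minus[OF assms(1-3)]
    by (simp add: a_minus_def linear_maps_add[OF assms(3)])
  then show ?thesis
    using linear_maps_closed[OF assms(3)] assms(4,5)
    by (metis N.M.a_inv_closed N.M.minus_equality N.M.minus_minus N.M.r_neg a_minus_def)
qed

text \<open>Kernels are the submodules to which the minimality of \<open>tensor_null\<close> is
  applied.\<close>

lemma linear_maps_kernel_submodule:
  assumes "module K M" "module K N" "h \<in> linear_maps K M N"
  shows "submodule {x \<in> carrier M. h x = \<zero>\<^bsub>N\<^esub>} K M"
proof -
  interpret M: module K M by fact
  interpret N: module K N by fact
  show ?thesis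
    using linear_mapsD[OF assms(3)] linear_maps_zero[OF assms] linear_maps_minus[OF assms]
    by (intro M.submoduleI) auto
qed

lemma bilinear_mapsI:
  assumes "\<And>a. a \<in> carrier A \<Longrightarrow> h a \<in> linear_maps K B M"
    and "\<And>b. b \<in> carrier B \<Longrightarrow> (\<lambda>a. h a b) \<in> linear_maps K A M"
  shows "h \<in> bilinear_maps K A B M"
  using assms by (simp add: bilinear_maps_def)

lemma bilinear_mapsD:
  assumes "h \<in> bilinear_maps K A B M"
  shows "a \<in> carrier A \<Longrightarrow> h a \<in> linear_maps K B M"
    and "b \<in> carrier B \<Longrightarrow> (\<lambda>a. h a b) \<in> linear_maps K A M"
  using assms by (simp_all add: bilinear_maps_def)

lemma bilinear_maps_rules:
  assumes "h \<in> bilinear_maps K A B M"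
  shows bilinear_maps_closed: "\<lbrakk>a \<in> carrier A; b \<in> carrier B\<rbrakk> \<Longrightarrow> h a b \<in> carrier M"
    and bilinear_maps_add_left: "\<lbrakk>a \<in> carrier A; a' \<in> carrier A; b \<in> carrier B\<rbrakk>
      \<Longrightarrow> h (a \<oplus>\<^bsub>A\<^esub> a') b = h a b \<oplus>\<^bsub>M\<^esub> h a' b"
    and bilinear_maps_add_right: "\<lbrakk>a \<in> carrier A; b \<in> carrier B; b' \<in> carrier B\<rbrakk>
      \<Longrightarrow> h a (b \<oplus>\<^bsub>B\<^esub> b') = h a b \<oplus>\<^bsub>M\<^esub> h a b'"
    and bilinear_maps_smult_left: "\<lbrakk>c \<in> carrier K; a \<in> carrier A; b \<in> carrier B\<rbrakk>
      \<Longrightarrow> h (c \<odot>\<^bsub>A\<^esub> a) b = c \<odot>\<^bsub>M\<^esub> h a b"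
    and bilinear_maps_smult_right: "\<lbrakk>c \<in> carrier K; a \<in> carrier A; b \<in> carrier B\<rbrakk>
      \<Longrightarrow> h a (c \<odot>\<^bsub>B\<^esub> b) = c \<odot>\<^bsub>M\<^esub> h a b"
  using linear_mapsD[OF bilinear_mapsD(1)[OF assms]] linear_mapsD[OF bilinear_mapsD(2)[OF assms]]
  by simp_all

lemma bilinear_maps_zero:
  assumes "module K A" "module K B" "module K M" "h \<in> bilinear_maps K A B M"
  shows "a \<in> carrier A \<Longrightarrow> h a \<zero>\<^bsub>B\<^esub> = \<zero>\<^bsub>M\<^esub>"
    and "b \<in> carrier B \<Longrightarrow> h \<zero>\<^bsub>A\<^esub> b = \<zero>\<^bsub>M\<^esub>"
  using linear_maps_zero[OF assms(2,3) bilinear_mapsD(1)[OF assms(4)]]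
    linear_maps_zero[OF assms(1,3) bilinear_mapsD(2)[OF assms(4)]]
  by simp_all

lemma bilinear_maps_comp:
  assumes "h \<in> bilinear_maps K A' B' M" "u \<in> linear_maps K A A'" "v \<in> linear_maps K B B'"
  shows "(\<lambda>a b. h (u a) (v b)) \<in> bilinear_maps K A B M"
  using bilinear_mapsD[OF assms(1)] assms(2,3)
  by (intro bilinear_mapsI linear_maps_comp[OF assms(3)] linear_maps_comp[OF assms(2)])
    (simp_all add: linear_maps_closed)

lemma linear_maps_bilinear_maps_comp:
  assumes "h \<in> bilinear_maps K A B M" "u \<in> linear_maps K M P"
  shows "(\<lambda>a b. u (h a b)) \<in> bilinear_maps K A B P"
  using bilinear_mapsD[OF assms(1)] by (intro bilinear_mapsI linear_maps_comp[OF _ assms(2)])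

lemma bilinear_maps_sum:
  assumes "module K M" "h \<in> bilinear_maps K A B M" "h' \<in> bilinear_maps K A B M"
  shows "(\<lambda>a b. h a b \<oplus>\<^bsub>M\<^esub> h' a b) \<in> bilinear_maps K A B M"
  using bilinear_mapsD[OF assms(2)] bilinear_mapsD[OF assms(3)]
  by (intro bilinear_mapsI linear_maps_sum[OF assms(1)])

lemma bilinear_maps_scale:
  assumes "module K M" "h \<in> bilinear_maps K A B M" "c \<in> carrier K"
  shows "(\<lambda>a b. c \<odot>\<^bsub>M\<^esub> h a b) \<in> bilinear_maps K A B M"
  using bilinear_mapsD[OF assms(2)]
  by (intro bilinear_mapsI linear_maps_scale[OF assms(1) _ assms(3)])

section \<open>Quotients of modules\<close>

lemma (in module) submodule_abelian_subgroup:
  assumes "submodule N R M"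
  shows "abelian_subgroup N M"
  using assms submodule.axioms(1) abelian_group_axioms
  by (intro abelian_subgroupI3 additive_subgroup.intro) blast+

text \<open>The intersection of an empty family is the whole type, which need not lie in the carrier
  of \<open>M\<close>; hence the second assumption.\<close>

lemma (in module) submodule_Inter:
  assumes "\<And>N. N \<in> \<N> \<Longrightarrow> submodule N R M" "\<N> \<noteq> {}"
  shows "submodule (\<Inter>\<N>) R M"
proof (rule submoduleI)
  show "\<zero>\<^bsub>M\<^esub> \<in> \<Inter>\<N>"
    using assms(1) submodule_abelian_subgroup additive_subgroup.zero_closed abelian_subgroup.axioms(1)
    by blast
  show "\<Inter>\<N> \<subseteq> carrier M"
    using assms(2) submoduleE(1)[OF assms(1)] by auto
qed (use submoduleE(3-5)[OF assms(1)] in auto)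

text \<open>The multiples by \<open>c\<close> of the elements of a coset can be too few (for
  \<open>c = 0\<close> there is only one), so the scalar action on cosets adds \<open>N\<close>
  back. The result is a full coset because \<open>N\<close> absorbs the multiples of its own
  elements.\<close>

lemma (in module) rcoset_smult:
  assumes N: "submodule N R M" and c: "c \<in> carrier R" and x: "x \<in> carrier M"
  shows "N <+>\<^bsub>M\<^esub> (\<lambda>y. c \<odot>\<^bsub>M\<^esub> y) ` (N +>\<^bsub>M\<^esub> x) = N +>\<^bsub>M\<^esub> c \<odot>\<^bsub>M\<^esub> x"
proof -
  note sub = submoduleE[OF N]
  have mem: "n \<in> carrier M" if "n \<in> N" for n
    using sub(1) that by auto
  have zero: "\<zero>\<^bsub>M\<^esub> \<in> N"
    using additive_subgroup.zero_closed abelian_subgroup.axioms(1) submodule_abelian_subgroup[OF N]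
    by blast
  show ?thesis
  proof (intro subset_antisym subsetI)
    fix y assume "y \<in> N <+>\<^bsub>M\<^esub> (\<lambda>y. c \<odot>\<^bsub>M\<^esub> y) ` (N +>\<^bsub>M\<^esub> x)"
    then obtain n n' where n: "n \<in> N" "n' \<in> N" and y: "y = n \<oplus>\<^bsub>M\<^esub> c \<odot>\<^bsub>M\<^esub> (n' \<oplus>\<^bsub>M\<^esub> x)"
      unfolding set_add_def' a_r_coset_def' by blast
    have "n \<oplus>\<^bsub>M\<^esub> c \<odot>\<^bsub>M\<^esub> n' \<in> N"
      using sub(4,5) c n by blast
    moreover have "y = (n \<oplus>\<^bsub>M\<^esub> c \<odot>\<^bsub>M\<^esub> n') \<oplus>\<^bsub>M\<^esub> c \<odot>\<^bsub>M\<^esub> x"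
      using mem[OF n(1)] mem[OF n(2)] c x y by (simp add: smult_r_distr M.a_assoc)
    ultimately show "y \<in> N +>\<^bsub>M\<^esub> c \<odot>\<^bsub>M\<^esub> x"
      unfolding a_r_coset_def' by blast
  next
    fix y assume "y \<in> N +>\<^bsub>M\<^esub> c \<odot>\<^bsub>M\<^esub> x"
    \<comment> \<open>The representative \<open>x\<close> alone, written with the zero element of
      \<open>N\<close>, already reaches every element of the target coset.\<close>
    then obtain n where "n \<in> N" and "y = n \<oplus>\<^bsub>M\<^esub> c \<odot>\<^bsub>M\<^esub> (\<zero>\<^bsub>M\<^esub> \<oplus>\<^bsub>M\<^esub> x)"
      using x unfolding a_r_coset_def' by auto
    then show "y \<in> N <+>\<^bsub>M\<^esub> (\<lambda>y. c \<odot>\<^bsub>M\<^esub> y) ` (N +>\<^bsub>M\<^esub> x)"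
      using zero unfolding set_add_def' a_r_coset_def' by blast
  qed
qed

text \<open>The class map respects addition and scalars and is onto, so every module law descends
  from \<open>M\<close>. Only the four module fields of \<open>Q\<close> are prescribed, since the
  ring fields of \<open>tensor_module\<close> are meaningless.\<close>

lemma (in module) quotient_module:
  fixes Q :: "('a, 'c set, 'q) module_scheme"
  assumes N: "submodule N R M"
    and Q: "carrier Q = a_rcosets\<^bsub>M\<^esub> N" "zero Q = N" "add Q = (\<lambda>U V. U <+>\<^bsub>M\<^esub> V)"
      "smult Q = (\<lambda>c U. N <+>\<^bsub>M\<^esub> (\<lambda>x. c \<odot>\<^bsub>M\<^esub> x) ` U)"
  shows "module R Q" and "(\<lambda>x. N +>\<^bsub>M\<^esub> x) \<in> linear_maps R M Q"
    and "carrier Q = (\<lambda>x. N +>\<^bsub>M\<^esub> x) ` carrier M"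
proof -
  interpret N: abelian_subgroup N M by (rule submodule_abelian_subgroup[OF N])
  let ?q = "\<lambda>x. N +>\<^bsub>M\<^esub> x"
  show carr: "carrier Q = ?q ` carrier M"
    unfolding Q(1) A_RCOSETS_def' by auto
  have add: "?q x \<oplus>\<^bsub>Q\<^esub> ?q y = ?q (x \<oplus>\<^bsub>M\<^esub> y)" if "x \<in> carrier M" "y \<in> carrier M" for x y
    using that by (simp add: Q N.a_rcos_sum)
  have smult: "c \<odot>\<^bsub>Q\<^esub> ?q x = ?q (c \<odot>\<^bsub>M\<^esub> x)" if "c \<in> carrier R" "x \<in> carrier M" for c x
    using that by (simp add: Q rcoset_smult[OF N])
  have zero: "\<zero>\<^bsub>Q\<^esub> = ?q \<zero>\<^bsub>M\<^esub>"
    using Q(2) N.a_rcos_const N.zero_closed by simp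
  show "?q \<in> linear_maps R M Q"
    using carr add smult by (intro linear_mapsI) auto
  show "module R Q"
  proof (intro moduleI abelian_groupI R.is_cring; (unfold carr)?; (elim imageE)?)
    fix U x assume *: "U = ?q x" "x \<in> carrier M"
    have "?q (\<ominus>\<^bsub>M\<^esub> x) \<oplus>\<^bsub>Q\<^esub> U = \<zero>\<^bsub>Q\<^esub>"
      using * by (simp add: add zero M.l_neg)
    then show "\<exists>V\<in>?q ` carrier M. V \<oplus>\<^bsub>Q\<^esub> U = \<zero>\<^bsub>Q\<^esub>"
      using *(2) by blast
  qed (auto simp: add smult zero M.a_ac smult_l_distr smult_r_distr smult_assoc1 M.a_assoc)
qed

section \<open>Free modules\<close>

lemma free_module_simps:
  "carrier (free_module K S) =
    {\<phi>. (\<forall>x. \<phi> x \<in> carrier K) \<and> {x. \<phi> x \<noteq> \<zero>\<^bsub>K\<^esub>} \<subseteq> S \<and> finite {x. \<phi> x \<noteq> \<zero>\<^bsub>K\<^esub>}}"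
  "\<zero>\<^bsub>free_module K S\<^esub> = (\<lambda>_. \<zero>\<^bsub>K\<^esub>)"
  "\<phi> \<oplus>\<^bsub>free_module K S\<^esub> \<psi> = (\<lambda>x. \<phi> x \<oplus>\<^bsub>K\<^esub> \<psi> x)"
  "c \<odot>\<^bsub>free_module K S\<^esub> \<phi> = (\<lambda>x. c \<otimes>\<^bsub>K\<^esub> \<phi> x)"
  by (simp_all add: free_module_def)

text \<open>Sums and multiples can cancel, so asking only for a finite superset \<open>T\<close> of
  the support avoids computing the support itself.\<close>

lemma (in cring) free_module_memI:
  assumes "\<And>x. \<phi> x \<in> carrier R" "finite T" "T \<subseteq> S" "\<And>x. x \<notin> T \<Longrightarrow> \<phi> x = \<zero>"
  shows "\<phi> \<in> carrier (free_module R S)"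
  using assms finite_subset[of "{x. \<phi> x \<noteq> \<zero>}" T] by (auto simp: free_module_simps)

lemma (in cring) free_module_module: "module R (free_module R S)"
proof (intro moduleI abelian_groupI is_cring)
  let ?F = "free_module R S"
  note mem = free_module_simps(1)[of R S]
  have sum: "(\<lambda>x. \<phi> x \<oplus> \<psi> x) \<in> carrier ?F" if "\<phi> \<in> carrier ?F" "\<psi> \<in> carrier ?F" for \<phi> \<psi>
    using that by (intro free_module_memI[where T = "{x. \<phi> x \<noteq> \<zero>} \<union> {x. \<psi> x \<noteq> \<zero>}"]) (auto simp: mem)
  have scale: "(\<lambda>x. c \<otimes> \<phi> x) \<in> carrier ?F" if "c \<in> carrier R" "\<phi> \<in> carrier ?F" for c \<phi>
    using that by (intro free_module_memI[where T = "{x. \<phi> x \<noteq> \<zero>}"]) (auto simp: mem)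
  show "\<exists>\<psi>\<in>carrier ?F. \<psi> \<oplus>\<^bsub>?F\<^esub> \<phi> = \<zero>\<^bsub>?F\<^esub>" if "\<phi> \<in> carrier ?F" for \<phi>
  \<comment> \<open>The negative is taken as a scalar multiple, so that \<open>scale\<close> yields
    its membership.\<close>
  proof (rule bexI[of _ "\<lambda>x. \<ominus> \<one> \<otimes> \<phi> x"])
    show "(\<lambda>x. \<ominus> \<one> \<otimes> \<phi> x) \<oplus>\<^bsub>?F\<^esub> \<phi> = \<zero>\<^bsub>?F\<^esub>"
      using that by (auto simp: free_module_simps l_minus l_neg)
  qed (use scale that in simp)
  show "\<zero>\<^bsub>?F\<^esub> \<in> carrier ?F"
    by (simp add: free_module_simps)
  show "\<phi> \<oplus>\<^bsub>?F\<^esub> \<psi> \<in> carrier ?F" if "\<phi> \<in> carrier ?F" "\<psi> \<in> carrier ?F" for \<phi> \<psi>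
    using that by (simp add: free_module_simps(3) sum)
  show "c \<odot>\<^bsub>?F\<^esub> \<phi> \<in> carrier ?F" if "c \<in> carrier R" "\<phi> \<in> carrier ?F" for c \<phi>
    using that by (simp add: free_module_simps(4) scale)
qed (auto simp: free_module_simps fun_eq_iff a_ac m_assoc l_distr r_distr)

lemma (in cring) free_gen_mem: "x \<in> S \<Longrightarrow> free_gen R x \<in> carrier (free_module R S)"
  by (rule free_module_memI[where T = "{x}"]) (auto simp: free_gen_def)

text \<open>The linear extension of \<open>h\<close> from generators to finitely supported
  functions. It is the sum inside \<open>tensor_lift\<close> for an uncurried \<open>h\<close>, so
  that lifting to a coset means evaluating \<open>free_lift\<close> at a representative.\<close>

definition free_lift :: "('k, 'r) ring_scheme \<Rightarrow> ('k, 'c, 'm) module_scheme \<Rightarrow>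
    ('x \<Rightarrow> 'c) \<Rightarrow> ('x \<Rightarrow> 'k) \<Rightarrow> 'c"
  where "free_lift K M h \<phi> = (\<Oplus>\<^bsub>M\<^esub>p\<in>{p. \<phi> p \<noteq> \<zero>\<^bsub>K\<^esub>}. \<phi> p \<odot>\<^bsub>M\<^esub> h p)"

text \<open>Summands outside the support are zero, so the sum may run over any finite superset of
  it. This provides a common index set for functions with different supports.\<close>

lemma (in module) free_lift_eq:
  assumes h: "h \<in> S \<rightarrow> carrier M" and \<phi>: "\<And>p. \<phi> p \<in> carrier R"
    and T: "finite T" "T \<subseteq> S" "\<And>p. p \<notin> T \<Longrightarrow> \<phi> p = \<zero>"
  shows "free_lift R M h \<phi> = (\<Oplus>\<^bsub>M\<^esub>p\<in>T. \<phi> p \<odot>\<^bsub>M\<^esub> h p)"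
  unfolding free_lift_def using assms
  by (intro M.add.finprod_mono_neutral_cong_left) (auto simp: Pi_def subset_iff)

lemma (in module) free_lift_linear:
  assumes h: "h \<in> S \<rightarrow> carrier M"
  shows "free_lift R M h \<in> linear_maps R (free_module R S) M"
proof (rule linear_mapsI)
  let ?F = "free_module R S"
  note mem = free_module_simps(1)[of R S]
  have h': "h p \<in> carrier M" if "p \<in> S" for p
    using h that by auto
  fix \<phi> assume \<phi>: "\<phi> \<in> carrier ?F"
  let ?T = "{p. \<phi> p \<noteq> \<zero>}"
  have T: "finite ?T" "?T \<subseteq> S" "\<And>p. \<phi> p \<in> carrier R"
    using \<phi> by (auto simp: mem)
  show "free_lift R M h \<phi> \<in> carrier M"
    unfolding free_lift_def using T h' by (intro M.finsum_closed) auto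
  show "free_lift R M h (c \<odot>\<^bsub>?F\<^esub> \<phi>) = c \<odot>\<^bsub>M\<^esub> free_lift R M h \<phi>" if c: "c \<in> carrier R" for c
  proof -
    have "free_lift R M h (c \<odot>\<^bsub>?F\<^esub> \<phi>) = (\<Oplus>\<^bsub>M\<^esub>p\<in>?T. (c \<otimes> \<phi> p) \<odot>\<^bsub>M\<^esub> h p)"
      unfolding free_module_simps using T c by (intro free_lift_eq[OF h]) auto
    also have "\<dots> = (\<Oplus>\<^bsub>M\<^esub>p\<in>?T. c \<odot>\<^bsub>M\<^esub> (\<phi> p \<odot>\<^bsub>M\<^esub> h p))"
      using T c h' by (intro M.finsum_cong') (auto simp: smult_assoc1)
    also have "\<dots> = c \<odot>\<^bsub>M\<^esub> free_lift R M h \<phi>"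
      unfolding free_lift_def using T c h' by (intro finsum_smult_ldistr[symmetric]) auto
    finally show ?thesis .
  qed
  fix \<psi> assume \<psi>: "\<psi> \<in> carrier ?F"
  \<comment> \<open>One index set for both functions; it also contains the support of their sum,
    which may be smaller through cancellation.\<close>
  let ?U = "?T \<union> {p. \<psi> p \<noteq> \<zero>}"
  have U: "finite ?U" "?U \<subseteq> S" "\<And>p. \<psi> p \<in> carrier R"
    using \<phi> \<psi> by (auto simp: mem)
  have "free_lift R M h (\<phi> \<oplus>\<^bsub>?F\<^esub> \<psi>) = (\<Oplus>\<^bsub>M\<^esub>p\<in>?U. (\<phi> p \<oplus> \<psi> p) \<odot>\<^bsub>M\<^esub> h p)"
    unfolding free_module_simps using T U by (intro free_lift_eq[OF h]) auto
  also have "\<dots> = (\<Oplus>\<^bsub>M\<^esub>p\<in>?U. \<phi> p \<odot>\<^bsub>M\<^esub> h p \<oplus>\<^bsub>M\<^esub> \<psi> p \<odot>\<^bsub>M\<^esub> h p)"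
    using T U h' by (intro M.finsum_cong') (auto simp: smult_l_distr)
  also have "\<dots> = (\<Oplus>\<^bsub>M\<^esub>p\<in>?U. \<phi> p \<odot>\<^bsub>M\<^esub> h p) \<oplus>\<^bsub>M\<^esub> (\<Oplus>\<^bsub>M\<^esub>p\<in>?U. \<psi> p \<odot>\<^bsub>M\<^esub> h p)"
    using T U h' by (intro M.finsum_addf) auto
  also have "\<dots> = free_lift R M h \<phi> \<oplus>\<^bsub>M\<^esub> free_lift R M h \<psi>"
    using T U by (subst (1 2) free_lift_eq[OF h, where T = ?U]) auto
  finally show "free_lift R M h (\<phi> \<oplus>\<^bsub>?F\<^esub> \<psi>) = free_lift R M h \<phi> \<oplus>\<^bsub>M\<^esub> free_lift R M h \<psi>" .
qed

lemma (in module) free_lift_gen: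
  assumes "h x \<in> carrier M"
  shows "free_lift R M h (free_gen R x) = h x"
proof -
  have "free_lift R M h (free_gen R x) = (\<Oplus>\<^bsub>M\<^esub>p\<in>{x}. free_gen R x p \<odot>\<^bsub>M\<^esub> h p)"
    using assms by (intro free_lift_eq[where S = "{x}"]) (auto simp: free_gen_def)
  then show ?thesis
    using assms by (simp add: free_gen_def)
qed

section \<open>Tensor products of modules\<close>

locale tensor_modules = A: module K A + B: module K B
  for K :: "('k, 'r) ring_scheme" and A :: "('k, 'a, 'm) module_scheme"
    and B :: "('k, 'b, 'n) module_scheme"
begin

abbreviation "F \<equiv> free_on_pairs K A B"
abbreviation "N \<equiv> tensor_null K A B"
abbreviation "T \<equiv> tensor_module K A B"
abbreviation "e a b \<equiv> free_gen K (a, b)"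
abbreviation pt (infixl \<open>\<box>\<close> 75) where "pt \<equiv> pure_tensor K A B"

lemma module_F: "module K F"
  by (rule A.R.free_module_module)

lemma e_mem: "\<lbrakk>a \<in> carrier A; b \<in> carrier B\<rbrakk> \<Longrightarrow> e a b \<in> carrier F"
  by (simp add: A.R.free_gen_mem)

text \<open>Each relation is the difference of the two sides of one bilinearity law, so killing it
  amounts to the law. Read from left to right this makes pure tensors bilinear; read from right to
  left it lets a bilinear map pass to the quotient.\<close>

lemma relations_vanish_iff:
  assumes "module K M" "h \<in> linear_maps K F M"
  shows "(\<forall>r\<in>bilinear_relations K A B. h r = \<zero>\<^bsub>M\<^esub>) \<longleftrightarrow> (\<lambda>a b. h (e a b)) \<in> bilinear_maps K A B M"
proof -
  interpret F: module K F by (rule module_F)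
  interpret M: module K M by fact
  note lin = linear_mapsD[OF assms(2)]
  note diff = linear_maps_diff_eq_zero_iff[OF module_F assms]
  \<comment> \<open>With an arbitrary predicate \<open>P\<close>, unfolding the set of relations is
    a purely logical matter; \<open>P\<close> then becomes vanishing under \<open>h\<close>.\<close>
  have "(\<forall>r\<in>bilinear_relations K A B. P r) \<longleftrightarrow>
    (\<forall>a\<in>carrier A. \<forall>a'\<in>carrier A. \<forall>b\<in>carrier B. P (e (a \<oplus>\<^bsub>A\<^esub> a') b \<ominus>\<^bsub>F\<^esub> (e a b \<oplus>\<^bsub>F\<^esub> e a' b))) \<and>
    (\<forall>a\<in>carrier A. \<forall>b\<in>carrier B. \<forall>b'\<in>carrier B. P (e a (b \<oplus>\<^bsub>B\<^esub> b') \<ominus>\<^bsub>F\<^esub> (e a b \<oplus>\<^bsub>F\<^esub> e a b'))) \<and>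
    (\<forall>c\<in>carrier K. \<forall>a\<in>carrier A. \<forall>b\<in>carrier B. P (e (c \<odot>\<^bsub>A\<^esub> a) b \<ominus>\<^bsub>F\<^esub> c \<odot>\<^bsub>F\<^esub> e a b)) \<and>
    (\<forall>c\<in>carrier K. \<forall>a\<in>carrier A. \<forall>b\<in>carrier B. P (e a (c \<odot>\<^bsub>B\<^esub> b) \<ominus>\<^bsub>F\<^esub> c \<odot>\<^bsub>F\<^esub> e a b))" for P
    unfolding bilinear_relations_def Let_def ball_Un by blast
  from this[of "\<lambda>r. h r = \<zero>\<^bsub>M\<^esub>"]
  have "(\<forall>r\<in>bilinear_relations K A B. h r = \<zero>\<^bsub>M\<^esub>) \<longleftrightarrow>
    (\<forall>a\<in>carrier A. \<forall>a'\<in>carrier A. \<forall>b\<in>carrier B. h (e (a \<oplus>\<^bsub>A\<^esub> a') b) = h (e a b) \<oplus>\<^bsub>M\<^esub> h (e a' b)) \<and>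
    (\<forall>a\<in>carrier A. \<forall>b\<in>carrier B. \<forall>b'\<in>carrier B. h (e a (b \<oplus>\<^bsub>B\<^esub> b')) = h (e a b) \<oplus>\<^bsub>M\<^esub> h (e a b')) \<and>
    (\<forall>c\<in>carrier K. \<forall>a\<in>carrier A. \<forall>b\<in>carrier B. h (e (c \<odot>\<^bsub>A\<^esub> a) b) = c \<odot>\<^bsub>M\<^esub> h (e a b)) \<and>
    (\<forall>c\<in>carrier K. \<forall>a\<in>carrier A. \<forall>b\<in>carrier B. h (e a (c \<odot>\<^bsub>B\<^esub> b)) = c \<odot>\<^bsub>M\<^esub> h (e a b))"
    by (simp add: diff e_mem lin cong: ball_cong)
  then show ?thesis
    using lin(1) by (auto simp: bilinear_maps_def linear_maps_def e_mem)
qed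

lemma relations_mem: "bilinear_relations K A B \<subseteq> carrier F"
proof -
  interpret F: module K F by (rule module_F)
  show ?thesis
    unfolding bilinear_relations_def Let_def by (auto simp: e_mem)
qed

lemma submodule_N: "submodule N K F"
proof -
  interpret F: module K F by (rule module_F)
  show ?thesis
    \<comment> \<open>The whole carrier belongs to the intersected family, which is therefore
      nonempty.\<close>
    unfolding tensor_null_def using relations_mem F.carrier_is_submodule
    by (intro F.submodule_Inter) blast+
qed

lemma tensor_module_simps:
  "carrier T = a_rcosets\<^bsub>F\<^esub> N" "\<zero>\<^bsub>T\<^esub> = N" "add T = (\<lambda>U V. U <+>\<^bsub>F\<^esub> V)"
  "smult T = (\<lambda>c U. N <+>\<^bsub>F\<^esub> (\<lambda>\<phi>. c \<odot>\<^bsub>F\<^esub> \<phi>) ` U)"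
  by (simp_all add: tensor_module_def Let_def)

lemma module_T: "module K T"
  and class_linear: "(\<lambda>\<phi>. N +>\<^bsub>F\<^esub> \<phi>) \<in> linear_maps K F T"
  and carrier_T: "carrier T = (\<lambda>\<phi>. N +>\<^bsub>F\<^esub> \<phi>) ` carrier F"
  by (rule module.quotient_module[OF module_F submodule_N tensor_module_simps])+

text \<open>The class map sends \<open>N\<close>, and with it every relation, to zero;
  \<open>relations_vanish_iff\<close> translates this into bilinearity.\<close>

lemma pt_bilinear: "pt \<in> bilinear_maps K A B T"
proof -
  interpret N: abelian_subgroup N F
    by (rule module.submodule_abelian_subgroup[OF module_F submodule_N])
  have "N +>\<^bsub>F\<^esub> r = \<zero>\<^bsub>T\<^esub>" if "r \<in> bilinear_relations K A B" for r
    using that N.a_rcos_const[of r] by (auto simp: tensor_module_simps tensor_null_def)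
  then show ?thesis
    using relations_vanish_iff[OF module_T class_linear]
    by (simp add: bilinear_maps_def pure_tensor_def[abs_def])
qed

text \<open>The universal property. The kernel of the free extension is a submodule containing the
  relations, so it contains \<open>N\<close> by minimality; hence the extension is constant on
  cosets and \<open>the_elem\<close> returns its value.\<close>

lemma
  assumes M: "module K M" and h: "h \<in> bilinear_maps K A B M"
  shows tensor_lift_linear: "tensor_lift K M h \<in> linear_maps K T M"
    and tensor_lift_pt: "\<lbrakk>a \<in> carrier A; b \<in> carrier B\<rbrakk> \<Longrightarrow> tensor_lift K M h (a \<box> b) = h a b"
proof -
  interpret F: module K F by (rule module_F)
  interpret M: module K M by fact
  interpret N: abelian_subgroup N F
    by (rule F.submodule_abelian_subgroup[OF submodule_N])
  let ?L = "free_lift K M (\<lambda>p. h (fst p) (snd p))" and ?q = "\<lambda>\<phi>. N +>\<^bsub>F\<^esub> \<phi>"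
  have L: "?L \<in> linear_maps K F M"
    using bilinear_maps_closed[OF h] by (intro M.free_lift_linear) auto
  have gen: "?L (e a b) = h a b" if "a \<in> carrier A" "b \<in> carrier B" for a b
    using that bilinear_maps_closed[OF h] by (simp add: M.free_lift_gen)
  have "(\<lambda>a b. ?L (e a b)) \<in> bilinear_maps K A B M"
    using bilinear_maps_rules[OF h] by (intro bilinear_mapsI linear_mapsI) (simp_all add: gen)
  then have "\<forall>r\<in>bilinear_relations K A B. ?L r = \<zero>\<^bsub>M\<^esub>"
    by (simp add: relations_vanish_iff[OF M L])
  then have "N \<subseteq> {\<phi> \<in> carrier F. ?L \<phi> = \<zero>\<^bsub>M\<^esub>}"
    unfolding tensor_null_def using linear_maps_kernel_submodule[OF module_F M L] relations_mem
    by (intro Inter_lower) blast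
  \<comment> \<open>An element of the coset is \<open>n + \<phi>\<close> with \<open>n\<close> in
    \<open>N\<close>, and \<open>?L\<close> sends \<open>n\<close> to zero; the zero of
    \<open>N\<close> shows that the image is not empty.\<close>
  then have "?L ` ?q \<phi> = {?L \<phi>}" if "\<phi> \<in> carrier F" for \<phi>
    using that N.zero_closed linear_maps_closed[OF L that]
    by (auto simp: a_r_coset_def' linear_maps_add[OF L])
  then have lift: "tensor_lift K M h (?q \<phi>) = ?L \<phi>" if "\<phi> \<in> carrier F" for \<phi>
    using that by (simp add: tensor_lift_def free_lift_def)
  show "tensor_lift K M h \<in> linear_maps K T M"
    using linear_mapsD[OF L]
    by (intro linear_mapsI)
      (auto simp: carrier_T lift simp flip: linear_mapsD(2,3)[OF class_linear])
  show "tensor_lift K M h (a \<box> b) = h a b" if "a \<in> carrier A" "b \<in> carrier B"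
    using that by (simp add: pure_tensor_def lift e_mem gen)
qed

lemmas pt_rules = bilinear_maps_rules[OF pt_bilinear]

text \<open>There is no case for scalar multiples because a scalar moves into the first factor of a
  pure tensor: every element is a plain sum of pure tensors. The induction runs over a finite set
  containing the support of a representative.\<close>

lemma tensor_induct [consumes 1, case_names pt add]:
  assumes "x \<in> carrier T"
    and pt: "\<And>a b. \<lbrakk>a \<in> carrier A; b \<in> carrier B\<rbrakk> \<Longrightarrow> P (a \<box> b)"
    and add: "\<And>x y. \<lbrakk>x \<in> carrier T; y \<in> carrier T; P x; P y\<rbrakk> \<Longrightarrow> P (x \<oplus>\<^bsub>T\<^esub> y)"
  shows "P x"
proof -
  interpret F: module K F by (rule module_F)
  let ?q = "\<lambda>\<phi>. N +>\<^bsub>F\<^esub> \<phi>"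
  have "P (?q \<phi>)" if "finite S" "S \<subseteq> carrier A \<times> carrier B" "\<phi> \<in> carrier F" "\<And>p. p \<notin> S \<Longrightarrow> \<phi> p = \<zero>\<^bsub>K\<^esub>"
    for S \<phi>
    using that
  proof (induction S arbitrary: \<phi> rule: finite_induct)
    case empty
    then have "\<phi> = \<zero>\<^bsub>F\<^esub>"
      by (auto simp: free_module_simps)
    \<comment> \<open>The empty sum is itself a pure tensor, with zero factors, so zero needs no
      case of its own.\<close>
    then have "?q \<phi> = \<zero>\<^bsub>A\<^esub> \<box> \<zero>\<^bsub>B\<^esub>"
      using linear_maps_zero[OF module_F module_T class_linear]
        bilinear_maps_zero(1)[OF A.module_axioms B.module_axioms module_T pt_bilinear]
      by simp
    then show ?case
      using pt by simp
  next
    case (insert p S)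
    obtain a b where p: "p = (a, b)" "a \<in> carrier A" "b \<in> carrier B"
      using insert.prems(1) by auto
    \<comment> \<open>\<open>\<psi>\<close> is \<open>\<phi>\<close> with its value at
      \<open>p\<close> removed; it vanishes outside \<open>S\<close>, so the induction hypothesis
      applies to it.\<close>
    define \<psi> where "\<psi> = (\<lambda>p'. if p' = p then \<zero>\<^bsub>K\<^esub> else \<phi> p')"
    have carr: "\<phi> p' \<in> carrier K" for p'
      using insert.prems(2) by (cases p') (simp add: free_module_simps)
    have \<psi>: "\<psi> \<in> carrier F"
      using insert carr by (intro A.R.free_module_memI[where T = S]) (auto simp: \<psi>_def)
    have "\<phi> = \<phi> p \<odot>\<^bsub>F\<^esub> e a b \<oplus>\<^bsub>F\<^esub> \<psi>"
      using carr p(1) by (auto simp: free_module_simps free_gen_def \<psi>_def fun_eq_iff)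
    then have "?q \<phi> = \<phi> p \<odot>\<^bsub>T\<^esub> ?q (e a b) \<oplus>\<^bsub>T\<^esub> ?q \<psi>"
      using linear_mapsD(2,3)[OF class_linear] carr \<psi> p by (metis F.smult_closed e_mem)
    also have "\<dots> = (\<phi> p \<odot>\<^bsub>A\<^esub> a) \<box> b \<oplus>\<^bsub>T\<^esub> ?q \<psi>"
      using carr p by (simp add: pt_rules(4) flip: pure_tensor_def)
    finally show ?case
      using insert.IH[OF _ \<psi>] insert.prems p carr \<psi> linear_maps_closed[OF class_linear]
      by (auto simp: \<psi>_def pt_rules(1) intro!: add pt)
  qed
  note * = this
  obtain \<phi> where \<phi>: "\<phi> \<in> carrier F" and x: "x = ?q \<phi>"
    using \<open>x \<in> carrier T\<close> unfolding carrier_T by blast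
  have "finite {p. \<phi> p \<noteq> \<zero>\<^bsub>K\<^esub>}" "{p. \<phi> p \<noteq> \<zero>\<^bsub>K\<^esub>} \<subseteq> carrier A \<times> carrier B"
    using \<phi> by (simp_all add: free_module_simps(1))
  from *[OF this \<phi>] show ?thesis
    unfolding x by blast
qed

lemma tensor_ext:
  assumes "u \<in> linear_maps K T M" "v \<in> linear_maps K T M" "x \<in> carrier T"
    and "\<And>a b. \<lbrakk>a \<in> carrier A; b \<in> carrier B\<rbrakk> \<Longrightarrow> u (a \<box> b) = v (a \<box> b)"
  shows "u x = v x"
  using assms(3)
  by (induction rule: tensor_induct) (simp_all add: assms(4) linear_maps_add[OF assms(1)] linear_maps_add[OF assms(2)])

text \<open>For fixed \<open>V\<close>, bilinearity of the inner lift in \<open>a\<close> and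
  \<open>b\<close> consists of equations between linear maps in \<open>V\<close>; on pure tensors
  they are the assumption \<open>left\<close>. Only then does the outer lift have a meaning, and its
  linearity in \<open>V\<close> is in turn checked on pure tensors in place of
  \<open>U\<close>.\<close>

lemma
  assumes M: "module K M"
    and right: "\<And>a b. \<lbrakk>a \<in> carrier A; b \<in> carrier B\<rbrakk> \<Longrightarrow> H a b \<in> bilinear_maps K A B M"
    and left: "\<And>a' b'. \<lbrakk>a' \<in> carrier A; b' \<in> carrier B\<rbrakk>
      \<Longrightarrow> (\<lambda>a b. H a b a' b') \<in> bilinear_maps K A B M"
  shows tensor_lift2_bilinear:
      "(\<lambda>U V. tensor_lift K M (\<lambda>a b. tensor_lift K M (H a b) V) U) \<in> bilinear_maps K T T M"
    and tensor_lift2_pt: "\<lbrakk>a \<in> carrier A; b \<in> carrier B; a' \<in> carrier A; b' \<in> carrier B\<rbrakk>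
      \<Longrightarrow> tensor_lift K M (\<lambda>a b. tensor_lift K M (H a b) (a' \<box> b')) (a \<box> b) = H a b a' b'"
proof -
  let ?h = "\<lambda>V a b. tensor_lift K M (H a b) V"
  have inner: "tensor_lift K M (H a b) \<in> linear_maps K T M" if "a \<in> carrier A" "b \<in> carrier B" for a b
    using tensor_lift_linear[OF M right] that .
  note sum = linear_maps_sum[OF M] and scale = linear_maps_scale[OF M]
  note H = tensor_lift_pt[OF M right] and l = bilinear_maps_rules[OF left]
  have outer: "?h V \<in> bilinear_maps K A B M" if V: "V \<in> carrier T" for V
  proof (intro bilinear_mapsI linear_mapsI)
    fix a b assume a: "a \<in> carrier A" and b: "b \<in> carrier B"
    \<comment> \<open>The same membership is a goal once for each of the two variables.\<close>
    show "?h V a b \<in> carrier M" "?h V a b \<in> carrier M"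
      using linear_maps_closed[OF inner] a b V by simp_all
    show "?h V (a \<oplus>\<^bsub>A\<^esub> a') b = ?h V a b \<oplus>\<^bsub>M\<^esub> ?h V a' b" if "a' \<in> carrier A" for a'
      by (rule tensor_ext[OF inner sum[OF inner inner] V]) (use a b that in \<open>simp_all add: H l\<close>)
    show "?h V a (b \<oplus>\<^bsub>B\<^esub> b') = ?h V a b \<oplus>\<^bsub>M\<^esub> ?h V a b'" if "b' \<in> carrier B" for b'
      by (rule tensor_ext[OF inner sum[OF inner inner] V]) (use a b that in \<open>simp_all add: H l\<close>)
    show "?h V (c \<odot>\<^bsub>A\<^esub> a) b = c \<odot>\<^bsub>M\<^esub> ?h V a b" "?h V a (c \<odot>\<^bsub>B\<^esub> b) = c \<odot>\<^bsub>M\<^esub> ?h V a b"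
      if "c \<in> carrier K" for c
      by (rule tensor_ext[OF inner scale[OF inner] V]; use a b that in \<open>simp add: H l\<close>)+
  qed
  note lift = tensor_lift_linear[OF M outer]
  show "(\<lambda>U V. tensor_lift K M (?h V) U) \<in> bilinear_maps K T T M"
  proof (intro bilinear_mapsI)
    fix U assume U: "U \<in> carrier T"
    interpret T: module K T by (rule module_T)
    show "(\<lambda>V. tensor_lift K M (?h V) U) \<in> linear_maps K T M"
    proof (intro linear_mapsI)
      fix V assume V: "V \<in> carrier T"
      show "tensor_lift K M (?h V) U \<in> carrier M"
        using linear_maps_closed[OF lift] U V by simp
      show "tensor_lift K M (?h (V \<oplus>\<^bsub>T\<^esub> W)) U = tensor_lift K M (?h V) U \<oplus>\<^bsub>M\<^esub> tensor_lift K M (?h W) U"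
        if W: "W \<in> carrier T" for W
        by (rule tensor_ext[OF lift sum[OF lift lift] U])
          (use V W in \<open>simp_all add: tensor_lift_pt[OF M outer] linear_maps_add[OF inner]\<close>)
      show "tensor_lift K M (?h (c \<odot>\<^bsub>T\<^esub> V)) U = c \<odot>\<^bsub>M\<^esub> tensor_lift K M (?h V) U"
        if c: "c \<in> carrier K" for c
        by (rule tensor_ext[OF lift scale[OF lift] U])
          (use V c in \<open>simp_all add: tensor_lift_pt[OF M outer] linear_maps_smult[OF inner]\<close>)
    qed
  qed (use lift in simp)
  show "tensor_lift K M (?h (a' \<box> b')) (a \<box> b) = H a b a' b'"
    if "a \<in> carrier A" "b \<in> carrier B" "a' \<in> carrier A" "b' \<in> carrier B"
    using that by (simp add: tensor_lift_pt[OF M outer] H pt_rules)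
qed

lemma bilinear_ext:
  assumes u: "u \<in> bilinear_maps K T T M" and v: "v \<in> bilinear_maps K T T M"
    and x: "x \<in> carrier T" and y: "y \<in> carrier T"
    and eq: "\<And>a b a' b'. \<lbrakk>a \<in> carrier A; b \<in> carrier B; a' \<in> carrier A; b' \<in> carrier B\<rbrakk>
      \<Longrightarrow> u (a \<box> b) (a' \<box> b') = v (a \<box> b) (a' \<box> b')"
  shows "u x y = v x y"
proof (rule tensor_ext[OF bilinear_mapsD(2)[OF u y] bilinear_mapsD(2)[OF v y] x])
  fix a b assume ab: "a \<in> carrier A" "b \<in> carrier B"
  note p = pt_rules(1)[OF ab]
  show "u (a \<box> b) y = v (a \<box> b) y"
    by (rule tensor_ext[OF bilinear_mapsD(1)[OF u p] bilinear_mapsD(1)[OF v p] y]) (rule eq[OF ab])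
qed

lemma pt_zero: "a \<in> carrier A \<Longrightarrow> a \<box> \<zero>\<^bsub>B\<^esub> = \<zero>\<^bsub>T\<^esub>" "b \<in> carrier B \<Longrightarrow> \<zero>\<^bsub>A\<^esub> \<box> b = \<zero>\<^bsub>T\<^esub>"
  using bilinear_maps_zero[OF A.module_axioms B.module_axioms module_T pt_bilinear]
  by simp_all

text \<open>\<open>m\<close> and \<open>n\<close> are left open because the product uses two
  multiplications, while each summand of the bracket uses one multiplication and one
  bracket.\<close>

lemma pt_bilinear_right:
  assumes "m \<in> bilinear_maps K A A A" "n \<in> bilinear_maps K B B B" "a \<in> carrier A" "b \<in> carrier B"
  shows "(\<lambda>a' b'. m a a' \<box> n b b') \<in> bilinear_maps K A B T"
  by (rule bilinear_maps_comp[OF pt_bilinear])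
    (rule bilinear_mapsD(1)[OF assms(1,3)] bilinear_mapsD(1)[OF assms(2,4)])+

lemma pt_bilinear_left:
  assumes "m \<in> bilinear_maps K A A A" "n \<in> bilinear_maps K B B B" "a' \<in> carrier A" "b' \<in> carrier B"
  shows "(\<lambda>a b. m a a' \<box> n b b') \<in> bilinear_maps K A B T"
  by (rule bilinear_maps_comp[OF pt_bilinear])
    (rule bilinear_mapsD(2)[OF assms(1,3)] bilinear_mapsD(2)[OF assms(2,4)])+

end

section \<open>Tensor products of associative algebras\<close>

locale tensor_algebras = A: assoc_algebra K A + B: assoc_algebra K B
  for K :: "('k, 'r) ring_scheme" and A :: "('k, 'a, 'm) module_scheme"
    and B :: "('k, 'b, 'n) module_scheme"

sublocale tensor_algebras \<subseteq> tensor_modules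
  by unfold_locales

lemma (in assoc_algebra) mult_bilinear: "mult A \<in> bilinear_maps K A A A"
  by (intro bilinear_mapsI linear_mapsI)
    (simp_all add: l_distr r_distr smult_mult_left smult_mult_right)

lemma (in lie_algebra) bracket_bilinear: "br \<in> bilinear_maps K L L L"
  by (intro bilinear_mapsI linear_mapsI)
    (simp_all add: br_closed br_add_left br_add_right br_smult_left br_smult_right)

context tensor_algebras
begin

abbreviation times (infixl \<open>\<star>\<close> 70) where "times \<equiv> tensor_mult K A B"

lemma times_bilinear: "times \<in> bilinear_maps K T T T"
  and times_pt: "\<lbrakk>a \<in> carrier A; b \<in> carrier B; a' \<in> carrier A; b' \<in> carrier B\<rbrakk>
    \<Longrightarrow> a \<box> b \<star> a' \<box> b' = (a \<otimes>\<^bsub>A\<^esub> a') \<box> (b \<otimes>\<^bsub>B\<^esub> b')"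
proof -
  note right = pt_bilinear_right[OF A.mult_bilinear B.mult_bilinear]
    and left = pt_bilinear_left[OF A.mult_bilinear B.mult_bilinear]
  show "times \<in> bilinear_maps K T T T"
    unfolding tensor_mult_def[abs_def] by (rule tensor_lift2_bilinear[OF module_T right left])
  show "a \<box> b \<star> a' \<box> b' = (a \<otimes>\<^bsub>A\<^esub> a') \<box> (b \<otimes>\<^bsub>B\<^esub> b')"
    if "a \<in> carrier A" "b \<in> carrier B" "a' \<in> carrier A" "b' \<in> carrier B"
    unfolding tensor_mult_def by (rule tensor_lift2_pt[OF module_T right left]) (simp_all add: that)
qed

lemmas times_rules = bilinear_maps_rules[OF times_bilinear]

text \<open>The identity is trilinear: both sides are additive in \<open>z\<close>, so induction
  reduces \<open>z\<close> to a pure tensor, and what remains is an equality of bilinear maps in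
  \<open>x\<close> and \<open>y\<close>.\<close>

lemma times_assoc:
  assumes "x \<in> carrier T" "y \<in> carrier T" "z \<in> carrier T"
  shows "x \<star> y \<star> z = x \<star> (y \<star> z)"
  using assms(3)
proof (induction rule: tensor_induct)
  case (pt a b)
  note p = pt_rules(1)[OF pt]
  show ?case
  proof (rule bilinear_ext[OF _ _ assms(1,2)])
    show "(\<lambda>x y. x \<star> y \<star> a \<box> b) \<in> bilinear_maps K T T T"
      by (rule linear_maps_bilinear_maps_comp[OF times_bilinear bilinear_mapsD(2)[OF times_bilinear p]])
    show "(\<lambda>x y. x \<star> (y \<star> a \<box> b)) \<in> bilinear_maps K T T T"
      by (rule bilinear_maps_comp[OF times_bilinear linear_maps_id bilinear_mapsD(2)[OF times_bilinear p]])
  qed (use pt in \<open>simp add: times_pt A.m_assoc B.m_assoc\<close>)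
next
  case (add z z')
  then show ?case
    using assms(1,2) by (simp add: times_rules)
qed

lemma times_one:
  assumes "x \<in> carrier T"
  shows "\<one>\<^bsub>A\<^esub> \<box> \<one>\<^bsub>B\<^esub> \<star> x = x" "x \<star> \<one>\<^bsub>A\<^esub> \<box> \<one>\<^bsub>B\<^esub> = x"
  using assms by (induction rule: tensor_induct) (simp_all add: times_pt times_rules pt_rules)

text \<open>\<open>R\<close> may carry further fields. The hypothesis holds for the tensor records
  of both cases, with or without a bracket, so the algebra structure is established once for all of
  them.\<close>

lemma tensor_algebra_simps:
  assumes "module.truncate R = tensor_algebra K A B"
  shows "carrier R = carrier T" "zero R = zero T" "add R = add T" "smult R = smult T"
    "mult R = times" "one R = \<one>\<^bsub>A\<^esub> \<box> \<one>\<^bsub>B\<^esub>"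
  using assms[THEN arg_cong, of carrier] assms[THEN arg_cong, of zero] assms[THEN arg_cong, of add]
    assms[THEN arg_cong, of smult] assms[THEN arg_cong, of mult] assms[THEN arg_cong, of one]
  by (simp_all add: module.truncate_def tensor_algebra_def)

lemma assoc_algebra_tensor:
  assumes "module.truncate R = tensor_algebra K A B"
  shows "assoc_algebra K R"
proof -
  interpret T: module K T by (rule module_T)
  note R = tensor_algebra_simps[OF assms]
  have "\<exists>y\<in>carrier T. y \<oplus>\<^bsub>T\<^esub> x = \<zero>\<^bsub>T\<^esub>" if "x \<in> carrier T" for x
    using that T.M.l_neg[OF that] by blast
  then have "abelian_group R"
    by (intro abelian_groupI) (simp_all add: R T.M.a_ac)
  moreover have "monoid R"
    by (intro monoidI) (simp_all add: R times_rules times_assoc times_one pt_rules)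
  ultimately have "ring R"
    by (intro ringI) (simp_all add: R times_rules)
  moreover have "module K R"
    using \<open>abelian_group R\<close>
    by (intro moduleI A.R.is_cring) (simp_all add: R T.smult_l_distr T.smult_r_distr T.smult_assoc1)
  ultimately show ?thesis
    by (intro assoc_algebra.intro assoc_algebra_axioms.intro) (simp_all add: R times_rules)
qed

end

section \<open>Tensor products of linear maps\<close>

lemma
  assumes "module K A" "module K B" "module K C" "module K D"
    and u: "u \<in> linear_maps K A C" and v: "v \<in> linear_maps K B D"
  shows tensor_map_linear:
      "tensor_map K C D u v \<in> linear_maps K (tensor_module K A B) (tensor_module K C D)"
    and tensor_map_pt: "\<lbrakk>a \<in> carrier A; b \<in> carrier B\<rbrakk>
      \<Longrightarrow> tensor_map K C D u v (pure_tensor K A B a b) = pure_tensor K C D (u a) (v b)"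
proof -
  interpret AB: tensor_modules K A B using assms by (simp add: tensor_modules.intro)
  interpret CD: tensor_modules K C D using assms by (simp add: tensor_modules.intro)
  have "(\<lambda>a b. pure_tensor K C D (u a) (v b)) \<in> bilinear_maps K A B CD.T"
    by (rule bilinear_maps_comp[OF CD.pt_bilinear u v])
  from AB.tensor_lift_linear[OF CD.module_T this] AB.tensor_lift_pt[OF CD.module_T this]
  show "tensor_map K C D u v \<in> linear_maps K AB.T CD.T"
    and "\<lbrakk>a \<in> carrier A; b \<in> carrier B\<rbrakk>
      \<Longrightarrow> tensor_map K C D u v (pure_tensor K A B a b) = pure_tensor K C D (u a) (v b)"
    by (simp_all add: tensor_map_def)
qed

section \<open>Derivations of tensor products\<close>

lemma
  fixes A :: "('k, 'a, 'm) diff_alg_scheme" and B :: "('k, 'b, 'n) diff_alg_scheme"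
  assumes "module K A" "module K B" "l \<in> carrier K"
    and dA: "der A \<in> linear_maps K A A" and dB: "der B \<in> linear_maps K B B"
  shows tensor_der_linear: "tensor_der K l A B \<in> linear_maps K (tensor_module K A B) (tensor_module K A B)"
    and tensor_der_pt: "\<lbrakk>a \<in> carrier A; b \<in> carrier B\<rbrakk>
      \<Longrightarrow> tensor_der K l A B (pure_tensor K A B a b) =
        pure_tensor K A B (der A a) b \<oplus>\<^bsub>tensor_module K A B\<^esub> pure_tensor K A B a (der B b)
        \<oplus>\<^bsub>tensor_module K A B\<^esub> l \<odot>\<^bsub>tensor_module K A B\<^esub> pure_tensor K A B (der A a) (der B b)"
    and tensor_mder_linear: "tensor_mder K l A B \<in> linear_maps K (tensor_module K A B) (tensor_module K A B)"
    and tensor_mder_pt: "\<lbrakk>a \<in> carrier A; b \<in> carrier B\<rbrakk>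
      \<Longrightarrow> tensor_mder K l A B (pure_tensor K A B a b) =
        pure_tensor K A B (der A a) b \<oplus>\<^bsub>tensor_module K A B\<^esub> pure_tensor K A B a (der B b)
        \<oplus>\<^bsub>tensor_module K A B\<^esub> l \<odot>\<^bsub>tensor_module K A B\<^esub> pure_tensor K A B a b"
proof -
  interpret AB: tensor_modules K A B using assms by (simp add: tensor_modules.intro)
  note intros = bilinear_maps_sum[OF AB.module_T] bilinear_maps_scale[OF AB.module_T _ \<open>l \<in> carrier K\<close>]
    bilinear_maps_comp[OF AB.pt_bilinear] dA dB linear_maps_id
  have 1: "(\<lambda>a b. pure_tensor K A B (der A a) b \<oplus>\<^bsub>AB.T\<^esub> pure_tensor K A B a (der B b)
      \<oplus>\<^bsub>AB.T\<^esub> l \<odot>\<^bsub>AB.T\<^esub> pure_tensor K A B (der A a) (der B b)) \<in> bilinear_maps K A B AB.T"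
    by (intro intros)
  have 2: "(\<lambda>a b. pure_tensor K A B (der A a) b \<oplus>\<^bsub>AB.T\<^esub> pure_tensor K A B a (der B b)
      \<oplus>\<^bsub>AB.T\<^esub> l \<odot>\<^bsub>AB.T\<^esub> pure_tensor K A B a b) \<in> bilinear_maps K A B AB.T"
    by (intro intros)
  show "tensor_der K l A B \<in> linear_maps K AB.T AB.T" "tensor_mder K l A B \<in> linear_maps K AB.T AB.T"
    using AB.tensor_lift_linear[OF AB.module_T 1] AB.tensor_lift_linear[OF AB.module_T 2]
    by (simp_all add: tensor_der_def tensor_mder_def Let_def)
  assume "a \<in> carrier A" "b \<in> carrier B"
  then show "tensor_der K l A B (pure_tensor K A B a b) =
        pure_tensor K A B (der A a) b \<oplus>\<^bsub>AB.T\<^esub> pure_tensor K A B a (der B b)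
        \<oplus>\<^bsub>AB.T\<^esub> l \<odot>\<^bsub>AB.T\<^esub> pure_tensor K A B (der A a) (der B b)"
    and "tensor_mder K l A B (pure_tensor K A B a b) =
        pure_tensor K A B (der A a) b \<oplus>\<^bsub>AB.T\<^esub> pure_tensor K A B a (der B b)
        \<oplus>\<^bsub>AB.T\<^esub> l \<odot>\<^bsub>AB.T\<^esub> pure_tensor K A B a b"
    using AB.tensor_lift_pt[OF AB.module_T 1] AB.tensor_lift_pt[OF AB.module_T 2]
    by (simp_all add: tensor_der_def tensor_mder_def Let_def)
qed

text \<open>Both sides are linear in \<open>x\<close>. On a pure tensor the maps act factor by
  factor and commute with the operators there, so the three summands match one by one. The pairs to
  which this is applied are \<open>f\<close> with \<open>j\<close>, \<open>f\<close> with
  \<open>k\<close>, and \<open>g\<close> with \<open>j\<close>.\<close>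

lemma
  fixes A :: "('k, 'a, 'm) diff_alg_scheme" and B :: "('k, 'b, 'n) diff_alg_scheme"
    and C :: "('k, 'c, 'p) diff_alg_scheme" and D :: "('k, 'd, 'q) diff_alg_scheme"
  assumes AB: "module K A" "module K B" and CD: "module K C" "module K D" and l: "l \<in> carrier K"
    and ders: "der A \<in> linear_maps K A A" "der B \<in> linear_maps K B B"
      "der C \<in> linear_maps K C C" "der D \<in> linear_maps K D D"
    and u: "u \<in> linear_maps K A C" "commutes_with_der A C u"
    and v: "v \<in> linear_maps K B D" "commutes_with_der B D v"
    and x: "x \<in> carrier (tensor_module K A B)"
  shows tensor_map_der:
      "tensor_map K C D u v (tensor_der K l A B x) = tensor_der K l C D (tensor_map K C D u v x)"
    and tensor_map_mder:
      "tensor_map K C D u v (tensor_mder K l A B x) = tensor_mder K l C D (tensor_map K C D u v x)"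
proof -
  interpret AB: tensor_modules K A B using AB by (simp add: tensor_modules.intro)
  interpret CD: tensor_modules K C D using CD by (simp add: tensor_modules.intro)
  interpret T: module K AB.T by (rule AB.module_T)
  note lin = tensor_map_linear[OF AB CD u(1) v(1)]
  note simps = tensor_map_pt[OF AB CD u(1) v(1)] linear_mapsD[OF lin] linear_mapsD[OF u(1)]
    linear_mapsD[OF v(1)] linear_mapsD[OF ders(1)] linear_mapsD[OF ders(2)] AB.pt_rules(1) l
    u(2)[unfolded commutes_with_der_def] v(2)[unfolded commutes_with_der_def]
  note dAB = AB l ders(1,2) and dCD = CD l ders(3,4)
  show "tensor_map K C D u v (tensor_der K l A B x) = tensor_der K l C D (tensor_map K C D u v x)"
    by (rule AB.tensor_ext[OF linear_maps_comp[OF tensor_der_linear[OF dAB] lin]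
          linear_maps_comp[OF lin tensor_der_linear[OF dCD]] x])
      (simp add: simps tensor_der_pt[OF dAB] tensor_der_pt[OF dCD])
  show "tensor_map K C D u v (tensor_mder K l A B x) = tensor_mder K l C D (tensor_map K C D u v x)"
    by (rule AB.tensor_ext[OF linear_maps_comp[OF tensor_mder_linear[OF dAB] lin]
          linear_maps_comp[OF lin tensor_mder_linear[OF dCD]] x])
      (simp add: simps tensor_mder_pt[OF dAB] tensor_mder_pt[OF dCD])
qed

lemma diff_tensor_simps:
  "module.truncate (diff_tensor K l A B) = tensor_algebra K A B"
  "der (diff_tensor K l A B) = tensor_der K l A B"
  "module.truncate (mdiff_tensor K l A B) = tensor_algebra K A B"
  "der (mdiff_tensor K l A B) = tensor_mder K l A B"
  "module.truncate (DP_tensor K l P Q) = tensor_algebra K P Q"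
  "der (DP_tensor K l P Q) = tensor_der K l P Q"
  "bracket (DP_tensor K l P Q) = tensor_bracket K P Q"
  "module.truncate (mDP_tensor K l P Q) = tensor_algebra K P Q"
  "der (mDP_tensor K l P Q) = tensor_mder K l P Q"
  "bracket (mDP_tensor K l P Q) = tensor_bracket K P Q"
  by (simp_all add: diff_tensor_def mdiff_tensor_def DP_tensor_def mDP_tensor_def module.defs
      diff_alg.defs tensor_algebra_def)

lemma (in tensor_algebras) times_comm:
  assumes "commutative_mult A" "commutative_mult B" "x \<in> carrier T" "y \<in> carrier T"
  shows "x \<star> y = y \<star> x"
proof (rule bilinear_ext[OF times_bilinear _ assms(3,4)])
  show "(\<lambda>x y. y \<star> x) \<in> bilinear_maps K T T T"
    using bilinear_mapsD[OF times_bilinear] by (intro bilinear_mapsI)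
qed (use assms(1,2) in \<open>simp add: times_pt commutative_mult_def\<close>)

lemma (in assoc_algebra) commutator_eq_zero:
  assumes "commutative_mult A" "x \<in> carrier A" "y \<in> carrier A"
  shows "commutator A x y = \<zero>"
  using assms by (simp add: commutative_mult_def commutator_def a_minus_def r_neg)

text \<open>For invertible \<open>l\<close> the Leibniz rule says that \<open>1 + l d\<close> is
  multiplicative, and the operator of the tensor product is the one whose \<open>1 + l d\<close> is
  the tensor product of the two given ones. The proof avoids dividing by \<open>l\<close>: on pure
  tensors both sides expand to the same fifteen summands.\<close>

lemma differential_algebra_tensor:
  fixes A :: "('k, 'a, 'm) diff_alg_scheme" and B :: "('k, 'b, 'n) diff_alg_scheme"
  assumes A: "differential_algebra K l A" and B: "differential_algebra K l B" and l: "l \<in> carrier K"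
  shows "differential_algebra K l (diff_tensor K l A B)"
proof -
  interpret A: assoc_algebra K A using A by (simp add: differential_algebra_def)
  interpret B: assoc_algebra K B using B by (simp add: differential_algebra_def)
  interpret tensor_algebras K A B ..
  interpret T: module K T by (rule module_T)
  have dA: "der A \<in> linear_maps K A A" and dB: "der B \<in> linear_maps K B B"
    and one: "der A \<one>\<^bsub>A\<^esub> = \<zero>\<^bsub>A\<^esub>" "der B \<one>\<^bsub>B\<^esub> = \<zero>\<^bsub>B\<^esub>"
    and leib: "\<lbrakk>x \<in> carrier A; y \<in> carrier A\<rbrakk> \<Longrightarrow> der A (x \<otimes>\<^bsub>A\<^esub> y) =
      der A x \<otimes>\<^bsub>A\<^esub> y \<oplus>\<^bsub>A\<^esub> x \<otimes>\<^bsub>A\<^esub> der A y \<oplus>\<^bsub>A\<^esub> l \<odot>\<^bsub>A\<^esub> (der A x \<otimes>\<^bsub>A\<^esub> der A y)"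
      "\<lbrakk>z \<in> carrier B; w \<in> carrier B\<rbrakk> \<Longrightarrow> der B (z \<otimes>\<^bsub>B\<^esub> w) =
      der B z \<otimes>\<^bsub>B\<^esub> w \<oplus>\<^bsub>B\<^esub> z \<otimes>\<^bsub>B\<^esub> der B w \<oplus>\<^bsub>B\<^esub> l \<odot>\<^bsub>B\<^esub> (der B z \<otimes>\<^bsub>B\<^esub> der B w)"
    for x y z w
    using A B by (simp_all add: differential_algebra_def)
  let ?d = "tensor_der K l A B"
  note d = A.module_axioms B.module_axioms l dA dB
  note lin = tensor_der_linear[OF d] and d_pt = tensor_der_pt[OF d]
  note closed = linear_mapsD(1)[OF dA] linear_mapsD(1)[OF dB]
  have prod: "?d (x \<star> y) = ?d x \<star> y \<oplus>\<^bsub>T\<^esub> x \<star> ?d y \<oplus>\<^bsub>T\<^esub> l \<odot>\<^bsub>T\<^esub> (?d x \<star> ?d y)"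
    if "x \<in> carrier T" "y \<in> carrier T" for x y
  proof (rule bilinear_ext[OF _ _ that])
    show "(\<lambda>x y. ?d (x \<star> y)) \<in> bilinear_maps K T T T"
      by (rule linear_maps_bilinear_maps_comp[OF times_bilinear lin])
    show "(\<lambda>x y. ?d x \<star> y \<oplus>\<^bsub>T\<^esub> x \<star> ?d y \<oplus>\<^bsub>T\<^esub> l \<odot>\<^bsub>T\<^esub> (?d x \<star> ?d y)) \<in> bilinear_maps K T T T"
      by (intro bilinear_maps_sum[OF module_T] bilinear_maps_scale[OF module_T _ l]
          bilinear_maps_comp[OF times_bilinear] lin linear_maps_id)
  next
    fix a b a' b' assume "a \<in> carrier A" "b \<in> carrier B" "a' \<in> carrier A" "b' \<in> carrier B"
    then show "?d (a \<box> b \<star> a' \<box> b') = ?d (a \<box> b) \<star> a' \<box> b' \<oplus>\<^bsub>T\<^esub> a \<box> b \<star> ?d (a' \<box> b') \<oplus>\<^bsub>T\<^esub>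
        l \<odot>\<^bsub>T\<^esub> (?d (a \<box> b) \<star> ?d (a' \<box> b'))"
      using l by (simp add: times_pt d_pt closed leib times_rules pt_rules T.smult_r_distr T.M.a_ac)
  qed
  \<comment> \<open>Each of the three summands has the derivative of a unit as a tensor
    factor.\<close>
  have "?d (\<one>\<^bsub>A\<^esub> \<box> \<one>\<^bsub>B\<^esub>) = \<zero>\<^bsub>T\<^esub>"
    using l by (simp add: d_pt one pt_zero)
  with lin prod assoc_algebra_tensor[of "diff_tensor K l A B"] show ?thesis
    by (simp add: differential_algebra_def diff_tensor_simps linear_maps_def
        tensor_algebra_simps[OF diff_tensor_simps(1)])
qed

text \<open>The modified rule says that \<open>d + l\<close> is a derivation in the ordinary sense,
  and the operator of the tensor product makes \<open>d + l\<close> the sum of the two given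
  derivations, each acting on its own factor. In the expansion on pure tensors the term with
  \<open>l\<close> occurs three times on each side.\<close>

lemma mdifferential_algebra_tensor:
  fixes A :: "('k, 'a, 'm) diff_alg_scheme" and B :: "('k, 'b, 'n) diff_alg_scheme"
  assumes A: "mdifferential_algebra K l A" and B: "mdifferential_algebra K l B" and l: "l \<in> carrier K"
  shows "mdifferential_algebra K l (mdiff_tensor K l A B)"
proof -
  interpret A: assoc_algebra K A using A by (simp add: mdifferential_algebra_def)
  interpret B: assoc_algebra K B using B by (simp add: mdifferential_algebra_def)
  interpret tensor_algebras K A B ..
  interpret T: module K T by (rule module_T)
  have dA: "der A \<in> linear_maps K A A" and dB: "der B \<in> linear_maps K B B"
    and leib: "\<lbrakk>x \<in> carrier A; y \<in> carrier A\<rbrakk> \<Longrightarrow> der A (x \<otimes>\<^bsub>A\<^esub> y) =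
      der A x \<otimes>\<^bsub>A\<^esub> y \<oplus>\<^bsub>A\<^esub> x \<otimes>\<^bsub>A\<^esub> der A y \<oplus>\<^bsub>A\<^esub> l \<odot>\<^bsub>A\<^esub> (x \<otimes>\<^bsub>A\<^esub> y)"
      "\<lbrakk>z \<in> carrier B; w \<in> carrier B\<rbrakk> \<Longrightarrow> der B (z \<otimes>\<^bsub>B\<^esub> w) =
      der B z \<otimes>\<^bsub>B\<^esub> w \<oplus>\<^bsub>B\<^esub> z \<otimes>\<^bsub>B\<^esub> der B w \<oplus>\<^bsub>B\<^esub> l \<odot>\<^bsub>B\<^esub> (z \<otimes>\<^bsub>B\<^esub> w)"
    for x y z w
    using A B by (simp_all add: mdifferential_algebra_def)
  let ?d = "tensor_mder K l A B"
  note d = A.module_axioms B.module_axioms l dA dB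
  note lin = tensor_mder_linear[OF d] and d_pt = tensor_mder_pt[OF d]
  note closed = linear_mapsD(1)[OF dA] linear_mapsD(1)[OF dB]
  have prod: "?d (x \<star> y) = ?d x \<star> y \<oplus>\<^bsub>T\<^esub> x \<star> ?d y \<oplus>\<^bsub>T\<^esub> l \<odot>\<^bsub>T\<^esub> (x \<star> y)"
    if "x \<in> carrier T" "y \<in> carrier T" for x y
  proof (rule bilinear_ext[OF _ _ that])
    show "(\<lambda>x y. ?d (x \<star> y)) \<in> bilinear_maps K T T T"
      by (rule linear_maps_bilinear_maps_comp[OF times_bilinear lin])
    show "(\<lambda>x y. ?d x \<star> y \<oplus>\<^bsub>T\<^esub> x \<star> ?d y \<oplus>\<^bsub>T\<^esub> l \<odot>\<^bsub>T\<^esub> (x \<star> y)) \<in> bilinear_maps K T T T"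
      by (intro bilinear_maps_sum[OF module_T] bilinear_maps_scale[OF module_T _ l]
          bilinear_maps_comp[OF times_bilinear] lin linear_maps_id)
  next
    fix a b a' b' assume "a \<in> carrier A" "b \<in> carrier B" "a' \<in> carrier A" "b' \<in> carrier B"
    then show "?d (a \<box> b \<star> a' \<box> b') = ?d (a \<box> b) \<star> a' \<box> b' \<oplus>\<^bsub>T\<^esub> a \<box> b \<star> ?d (a' \<box> b') \<oplus>\<^bsub>T\<^esub>
        l \<odot>\<^bsub>T\<^esub> (a \<box> b \<star> a' \<box> b')"
      using l by (simp add: times_pt d_pt closed leib times_rules pt_rules T.smult_r_distr T.M.a_ac)
  qed
  with lin assoc_algebra_tensor[of "mdiff_tensor K l A B"] show ?thesis
    by (simp add: mdifferential_algebra_def diff_tensor_simps linear_maps_def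
        tensor_algebra_simps[OF diff_tensor_simps(3)])
qed

section \<open>Tensor products of P-triples\<close>

text \<open>Only the factors carry Lie brackets; \<open>tensor_bracket\<close> inherits bilinearity
  from them, which is what a comparison on pure tensors requires.\<close>

locale tensor_poisson = tensor_algebras K A B + LA: lie_algebra K A "bracket A" + LB: lie_algebra K B "bracket B"
  for K :: "('k, 'r) ring_scheme" and A :: "('k, 'a, 'm) poisson_alg_scheme"
    and B :: "('k, 'b, 'n) poisson_alg_scheme"
begin

lemma tensor_bracket_bilinear: "tensor_bracket K A B \<in> bilinear_maps K T T T"
  and tensor_bracket_pt: "\<lbrakk>a \<in> carrier A; b \<in> carrier B; a' \<in> carrier A; b' \<in> carrier B\<rbrakk>
    \<Longrightarrow> tensor_bracket K A B (a \<box> b) (a' \<box> b') =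
      (a \<otimes>\<^bsub>A\<^esub> a') \<box> bracket B b b' \<oplus>\<^bsub>T\<^esub> bracket A a a' \<box> (b \<otimes>\<^bsub>B\<^esub> b')"
proof -
  note m = A.mult_bilinear LB.bracket_bilinear LA.bracket_bilinear B.mult_bilinear
  note right = bilinear_maps_sum[OF module_T pt_bilinear_right[OF m(1,2)] pt_bilinear_right[OF m(3,4)]]
    and left = bilinear_maps_sum[OF module_T pt_bilinear_left[OF m(1,2)] pt_bilinear_left[OF m(3,4)]]
  show "tensor_bracket K A B \<in> bilinear_maps K T T T"
    unfolding tensor_bracket_def[abs_def] by (rule tensor_lift2_bilinear[OF module_T right left])
  show "tensor_bracket K A B (a \<box> b) (a' \<box> b') =
      (a \<otimes>\<^bsub>A\<^esub> a') \<box> bracket B b b' \<oplus>\<^bsub>T\<^esub> bracket A a a' \<box> (b \<otimes>\<^bsub>B\<^esub> b')"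
    if "a \<in> carrier A" "b \<in> carrier B" "a' \<in> carrier A" "b' \<in> carrier B"
    unfolding tensor_bracket_def by (rule tensor_lift2_pt[OF module_T right left]) (simp_all add: that)
qed

end

text \<open>These are the hypotheses that do not involve the operators. They have the same form in
  both cases of the theorem, so the results below serve both.\<close>

locale tensor_ptriple = AB: tensor_poisson K A B + CD: tensor_algebras K C D
  for K :: "('k, 'r) ring_scheme" and A :: "('k, 'a, 'm) poisson_alg_scheme"
    and B :: "('k, 'b, 'n) poisson_alg_scheme" and C :: "('k, 'c, 'p) diff_alg_scheme"
    and D :: "('k, 'd, 'q) diff_alg_scheme" +
  fixes f g :: "'a \<Rightarrow> 'c" and j k :: "'b \<Rightarrow> 'd"
  assumes comm: "commutative_mult C" "commutative_mult D"
    and homs: "f \<in> algebra_homs K A C" "j \<in> algebra_homs K B D"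
    and lie: "g \<in> lie_homs K A (bracket A) C (commutator C)" "k \<in> lie_homs K B (bracket B) D (commutator D)"
    and P3: "ptriple_bracket A C f g" "ptriple_bracket B D j k"
    and P4: "ptriple_mult A C f g" "ptriple_mult B D j k"
begin

text \<open>Here \<open>F\<close> is a map, not the free module of the earlier locale. The sum in
  \<open>G\<close> is taken in the bare module \<open>CD.T\<close>, whose addition is shared by
  \<open>diff_tensor\<close> and \<open>mdiff_tensor\<close>.\<close>

definition "F = tensor_map K C D f j"
definition "G x = tensor_map K C D f k x \<oplus>\<^bsub>CD.T\<^esub> tensor_map K C D g j x"

lemma linear: "f \<in> linear_maps K A C" "g \<in> linear_maps K A C" "j \<in> linear_maps K B D" "k \<in> linear_maps K B D"
  using homs lie by (simp_all add: algebra_homs_def lie_homs_def)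

lemma hom_simps:
  "\<lbrakk>a \<in> carrier A; a' \<in> carrier A\<rbrakk> \<Longrightarrow> f (a \<otimes>\<^bsub>A\<^esub> a') = f a \<otimes>\<^bsub>C\<^esub> f a'"
  "\<lbrakk>b \<in> carrier B; b' \<in> carrier B\<rbrakk> \<Longrightarrow> j (b \<otimes>\<^bsub>B\<^esub> b') = j b \<otimes>\<^bsub>D\<^esub> j b'"
  "f \<one>\<^bsub>A\<^esub> = \<one>\<^bsub>C\<^esub>" "j \<one>\<^bsub>B\<^esub> = \<one>\<^bsub>D\<^esub>"
  "\<lbrakk>a \<in> carrier A; a' \<in> carrier A\<rbrakk> \<Longrightarrow> g (a \<otimes>\<^bsub>A\<^esub> a') = f a \<otimes>\<^bsub>C\<^esub> g a' \<oplus>\<^bsub>C\<^esub> f a' \<otimes>\<^bsub>C\<^esub> g a"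
  "\<lbrakk>b \<in> carrier B; b' \<in> carrier B\<rbrakk> \<Longrightarrow> k (b \<otimes>\<^bsub>B\<^esub> b') = j b \<otimes>\<^bsub>D\<^esub> k b' \<oplus>\<^bsub>D\<^esub> j b' \<otimes>\<^bsub>D\<^esub> k b"
  using homs P4 by (auto simp: algebra_homs_def ring_hom_def ptriple_mult_def)

lemma closed:
  "a \<in> carrier A \<Longrightarrow> f a \<in> carrier C" "a \<in> carrier A \<Longrightarrow> g a \<in> carrier C"
  "b \<in> carrier B \<Longrightarrow> j b \<in> carrier D" "b \<in> carrier B \<Longrightarrow> k b \<in> carrier D"
  using linear[THEN linear_maps_closed] by simp_all

lemma bracket_zero:
  "\<lbrakk>a \<in> carrier A; a' \<in> carrier A\<rbrakk> \<Longrightarrow> f (bracket A a a') = \<zero>\<^bsub>C\<^esub>"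
  "\<lbrakk>a \<in> carrier A; a' \<in> carrier A\<rbrakk> \<Longrightarrow> g (bracket A a a') = \<zero>\<^bsub>C\<^esub>"
  "\<lbrakk>b \<in> carrier B; b' \<in> carrier B\<rbrakk> \<Longrightarrow> j (bracket B b b') = \<zero>\<^bsub>D\<^esub>"
  "\<lbrakk>b \<in> carrier B; b' \<in> carrier B\<rbrakk> \<Longrightarrow> k (bracket B b b') = \<zero>\<^bsub>D\<^esub>"
  using P3 lie CD.A.commutator_eq_zero[OF comm(1)] CD.B.commutator_eq_zero[OF comm(2)]
  by (simp_all add: ptriple_bracket_def lie_homs_def closed flip: commutator_def)

lemmas modules = AB.A.module_axioms AB.B.module_axioms CD.A.module_axioms CD.B.module_axioms

lemma F_linear: "F \<in> linear_maps K AB.T CD.T"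
  and F_pt: "\<lbrakk>a \<in> carrier A; b \<in> carrier B\<rbrakk> \<Longrightarrow> F (AB.pt a b) = CD.pt (f a) (j b)"
  using tensor_map_linear[OF modules linear(1,3)] tensor_map_pt[OF modules linear(1,3)]
  by (simp_all add: F_def)

lemma G_linear: "G \<in> linear_maps K AB.T CD.T"
  and G_pt: "\<lbrakk>a \<in> carrier A; b \<in> carrier B\<rbrakk>
    \<Longrightarrow> G (AB.pt a b) = CD.pt (f a) (k b) \<oplus>\<^bsub>CD.T\<^esub> CD.pt (g a) (j b)"
  using linear_maps_sum[OF CD.module_T tensor_map_linear[OF modules linear(1,4)]
      tensor_map_linear[OF modules linear(2,3)]]
    tensor_map_pt[OF modules linear(1,4)] tensor_map_pt[OF modules linear(2,3)]
  by (simp_all add: G_def[abs_def])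

lemma F_times:
  assumes "x \<in> carrier AB.T" "y \<in> carrier AB.T"
  shows "F (AB.times x y) = CD.times (F x) (F y)"
  by (rule AB.bilinear_ext[OF linear_maps_bilinear_maps_comp[OF AB.times_bilinear F_linear]
        bilinear_maps_comp[OF CD.times_bilinear F_linear F_linear] assms])
    (simp add: AB.times_pt CD.times_pt F_pt closed hom_simps)

text \<open>On pure tensors, (P4) for \<open>A\<close> splits the summand with \<open>g\<close> and
  (P4) for \<open>B\<close> the summand with \<open>k\<close>. The four resulting terms are those of
  the right side, up to the order of two products.\<close>

lemma G_times:
  assumes "x \<in> carrier AB.T" "y \<in> carrier AB.T"
  shows "G (AB.times x y) = CD.times (F x) (G y) \<oplus>\<^bsub>CD.T\<^esub> CD.times (F y) (G x)"
proof (rule AB.bilinear_ext[OF _ _ assms])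
  interpret T: module K CD.T by (rule CD.module_T)
  show "(\<lambda>x y. G (AB.times x y)) \<in> bilinear_maps K AB.T AB.T CD.T"
    by (rule linear_maps_bilinear_maps_comp[OF AB.times_bilinear G_linear])
  \<comment> \<open>The arguments are exchanged here, so the composition lemma does not fit
    directly; its two linearity facts trade places instead.\<close>
  have "(\<lambda>x y. CD.times (F y) (G x)) \<in> bilinear_maps K AB.T AB.T CD.T"
    using bilinear_mapsD[OF bilinear_maps_comp[OF CD.times_bilinear F_linear G_linear]]
    by (intro bilinear_mapsI)
  then show "(\<lambda>x y. CD.times (F x) (G y) \<oplus>\<^bsub>CD.T\<^esub> CD.times (F y) (G x)) \<in> bilinear_maps K AB.T AB.T CD.T"
    by (intro bilinear_maps_sum[OF CD.module_T] bilinear_maps_comp[OF CD.times_bilinear F_linear G_linear])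
  fix a b a' b' assume ab: "a \<in> carrier A" "b \<in> carrier B" "a' \<in> carrier A" "b' \<in> carrier B"
  \<comment> \<open>The exchanged term has \<open>f a'\<close> before \<open>f a\<close> and
    \<open>j b'\<close> before \<open>j b\<close>. These two instances of commutativity, fixed in
    direction, reconcile it with the left side.\<close>
  have "f a' \<otimes>\<^bsub>C\<^esub> f a = f a \<otimes>\<^bsub>C\<^esub> f a'" "j b' \<otimes>\<^bsub>D\<^esub> j b = j b \<otimes>\<^bsub>D\<^esub> j b'"
    using comm ab closed by (simp_all add: commutative_mult_def)
  with ab show "G (AB.times (AB.pt a b) (AB.pt a' b')) =
      CD.times (F (AB.pt a b)) (G (AB.pt a' b')) \<oplus>\<^bsub>CD.T\<^esub> CD.times (F (AB.pt a' b')) (G (AB.pt a b))"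
    by (simp add: AB.times_pt CD.times_pt F_pt G_pt closed hom_simps CD.pt_rules CD.times_rules T.M.a_ac)
qed

text \<open>Under \<open>G\<close> each summand of the bracket splits in two, and the four terms
  contain a bracket under \<open>f\<close>, \<open>g\<close>, \<open>j\<close> and \<open>k\<close>
  respectively; that is why all four maps have to kill brackets.\<close>

lemma bracket_tensor_zero:
  assumes "x \<in> carrier AB.T" "y \<in> carrier AB.T"
  shows "F (tensor_bracket K A B x y) = \<zero>\<^bsub>CD.T\<^esub>" "G (tensor_bracket K A B x y) = \<zero>\<^bsub>CD.T\<^esub>"
proof -
  interpret T: module K CD.T by (rule CD.module_T)
  have zero: "(\<lambda>x y. \<zero>\<^bsub>CD.T\<^esub>) \<in> bilinear_maps K AB.T AB.T CD.T"
    by (intro bilinear_mapsI linear_mapsI) simp_all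
  note simps = AB.tensor_bracket_pt bracket_zero linear_mapsD[OF F_linear] linear_mapsD[OF G_linear]
    F_pt G_pt closed AB.LA.br_closed AB.LB.br_closed AB.pt_rules(1) CD.pt_zero
  show "F (tensor_bracket K A B x y) = \<zero>\<^bsub>CD.T\<^esub>"
    by (rule AB.bilinear_ext[OF linear_maps_bilinear_maps_comp[OF AB.tensor_bracket_bilinear F_linear] zero assms])
      (simp add: simps)
  show "G (tensor_bracket K A B x y) = \<zero>\<^bsub>CD.T\<^esub>"
    by (rule AB.bilinear_ext[OF linear_maps_bilinear_maps_comp[OF AB.tensor_bracket_bilinear G_linear] zero assms])
      (simp add: simps)
qed

text \<open>\<open>P\<close> and \<open>Q\<close> stand for the tensor records of either case. As
  \<open>Q\<close> is commutative, both sides of the bracket conditions in (P2) and (P3) are zero;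
  (P4) is \<open>G_times\<close>.\<close>

lemma ptriple:
  fixes P :: "('k, ('a \<times> 'b \<Rightarrow> 'k) set, 's) poisson_alg_scheme"
    and Q :: "('k, ('c \<times> 'd \<Rightarrow> 'k) set, 't) diff_alg_scheme"
  assumes P: "module.truncate P = tensor_algebra K A B" "bracket P = tensor_bracket K A B"
    and Q: "module.truncate Q = tensor_algebra K C D"
  shows "commutative_mult Q" "F \<in> algebra_homs K P Q"
    "G \<in> lie_homs K P (bracket P) Q (commutator Q)" "ptriple_bracket P Q F G" "ptriple_mult P Q F G"
proof -
  interpret Q: assoc_algebra K Q by (rule CD.assoc_algebra_tensor[OF Q])
  note simps = AB.tensor_algebra_simps[OF P(1)] CD.tensor_algebra_simps[OF Q] P(2)
  note FG_closed = linear_maps_closed[OF F_linear] linear_maps_closed[OF G_linear]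
  show Q_comm: "commutative_mult Q"
    using CD.times_comm[OF comm] by (simp add: commutative_mult_def simps)
  have PQ_linear: "linear_maps K P Q = linear_maps K AB.T CD.T"
    by (rule linear_maps_cong) (simp_all add: simps)
  have "F (AB.pt \<one>\<^bsub>A\<^esub> \<one>\<^bsub>B\<^esub>) = CD.pt \<one>\<^bsub>C\<^esub> \<one>\<^bsub>D\<^esub>"
    by (simp add: F_pt hom_simps)
  then show "F \<in> algebra_homs K P Q"
    using F_linear FG_closed linear_maps_add[OF F_linear]
    by (simp add: algebra_homs_def PQ_linear ring_hom_def simps F_times)
  have comm_zero: "commutator Q u v = \<zero>\<^bsub>CD.T\<^esub>" if "u \<in> carrier CD.T" "v \<in> carrier CD.T" for u v
    using Q.commutator_eq_zero[OF Q_comm] that by (simp add: simps)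
  show "G \<in> lie_homs K P (bracket P) Q (commutator Q)"
    using G_linear FG_closed by (simp add: lie_homs_def PQ_linear simps bracket_tensor_zero comm_zero)
  show "ptriple_bracket P Q F G"
    \<comment> \<open>The right side of (P3) is folded into a commutator, so that
      \<open>comm_zero\<close> applies to it as well.\<close>
    unfolding ptriple_bracket_def commutator_def[symmetric]
    using FG_closed by (simp add: simps bracket_tensor_zero comm_zero)
  show "ptriple_mult P Q F G"
    by (simp add: ptriple_mult_def simps G_times)
qed

end

lemma tensor_ptripleI:
  assumes "assoc_algebra K A" "assoc_algebra K B" "assoc_algebra K C" "assoc_algebra K D"
    and "lie_algebra K A (bracket A)" "lie_algebra K B (bracket B)"
    and "commutative_mult C" "commutative_mult D"
    and "f \<in> algebra_homs K A C" "j \<in> algebra_homs K B D"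
    and "ptriple_lie K A C g" "ptriple_lie K B D k"
    and "ptriple_bracket A C f g" "ptriple_bracket B D j k"
    and "ptriple_mult A C f g" "ptriple_mult B D j k"
  shows "tensor_ptriple K A B C D f g j k"
  using assms
  by (simp add: tensor_ptriple_def tensor_ptriple_axioms_def tensor_poisson_def tensor_algebras_def
      ptriple_lie_def)

text \<open>Beyond \<open>ptriple\<close> there remain, in each case, the operator structure on the
  tensor product of \<open>C\<close> and \<open>D\<close> and the commutation of the two maps with
  the operators.\<close>

theorem lemma3p6:
  fixes K :: "('k, 'r) ring_scheme" and l :: 'k
    and A :: "('k, 'a, 'm) poisson_alg_scheme" and B :: "('k, 'b, 'n) poisson_alg_scheme"
    and C :: "('k, 'c, 'p) diff_alg_scheme" and D :: "('k, 'd, 'q) diff_alg_scheme"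
    and f g :: "'a \<Rightarrow> 'c" and j k :: "'b \<Rightarrow> 'd"
  assumes "field_char_zero K" and "l \<in> carrier K"
  shows "(DP_algebra K l A \<and> DP_algebra K l B \<and> DP_triple K l A C f g \<and> DP_triple K l B D j k
      \<longrightarrow> DP_triple K l (DP_tensor K l A B) (diff_tensor K l C D)
            (tensor_map K C D f j)
            (\<lambda>x. tensor_map K C D f k x \<oplus>\<^bsub>diff_tensor K l C D\<^esub> tensor_map K C D g j x))
    \<and> (mDP_algebra K l A \<and> mDP_algebra K l B \<and> mDP_triple K l A C f g \<and> mDP_triple K l B D j k
      \<longrightarrow> mDP_triple K l (mDP_tensor K l A B) (mdiff_tensor K l C D)
            (tensor_map K C D f j)
            (\<lambda>x. tensor_map K C D f k x \<oplus>\<^bsub>mdiff_tensor K l C D\<^esub> tensor_map K C D g j x))"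
proof (intro conjI impI; elim conjE)
  assume AB: "DP_algebra K l A" "DP_algebra K l B"
    and CD: "DP_triple K l A C f g" "DP_triple K l B D j k"
  interpret tensor_ptriple K A B C D f g j k
    using AB CD by (intro tensor_ptripleI)
      (simp_all add: DP_algebra_def DP_triple_def differential_algebra_def DL_algebra_def)
  let ?P = "DP_tensor K l A B" and ?Q = "diff_tensor K l C D"
  note P = diff_tensor_simps(5,7)[of K l A B] and Q = diff_tensor_simps(1)[of K l C D]
  note simps = AB.tensor_algebra_simps[OF P(1)] CD.tensor_algebra_simps[OF Q] diff_tensor_simps(2,6)
  have ders: "der A \<in> linear_maps K A A" "der B \<in> linear_maps K B B"
    "der C \<in> linear_maps K C C" "der D \<in> linear_maps K D D"
    and comms: "commutes_with_der A C f" "commutes_with_der A C g"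
      "commutes_with_der B D j" "commutes_with_der B D k"
    using AB CD by (simp_all add: DP_algebra_def DP_triple_def differential_algebra_def ptriple_lie_def)
  note map_der = tensor_map_der[OF modules \<open>l \<in> carrier K\<close> ders]
  note lin = tensor_der_linear[OF modules(3,4) \<open>l \<in> carrier K\<close> ders(3,4)]
  have "commutes_with_der ?P ?Q F"
    using map_der[OF linear(1) comms(1) linear(3) comms(3)]
    by (simp add: commutes_with_der_def simps F_def)
  \<comment> \<open>\<open>G\<close> is a sum of two maps that commute with the operators, and the
    operator of the target is additive.\<close>
  moreover have "commutes_with_der ?P ?Q G"
    using map_der[OF linear(1) comms(1) linear(4) comms(4)]
      map_der[OF linear(2) comms(2) linear(3) comms(3)] linear_maps_add[OF lin]
      linear_maps_closed[OF tensor_map_linear[OF modules linear(1,4)]]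
      linear_maps_closed[OF tensor_map_linear[OF modules linear(2,3)]]
    by (simp add: commutes_with_der_def simps G_def)
  moreover have "differential_algebra K l ?Q"
    using CD \<open>l \<in> carrier K\<close> by (simp add: DP_triple_def differential_algebra_tensor)
  moreover have "tensor_map K C D f j = F"
    "(\<lambda>x. tensor_map K C D f k x \<oplus>\<^bsub>?Q\<^esub> tensor_map K C D g j x) = G"
    by (simp_all add: F_def G_def fun_eq_iff simps)
  ultimately show "DP_triple K l ?P ?Q (tensor_map K C D f j)
      (\<lambda>x. tensor_map K C D f k x \<oplus>\<^bsub>?Q\<^esub> tensor_map K C D g j x)"
    using ptriple[OF P Q] by (simp add: DP_triple_def ptriple_lie_def)
next
  assume AB: "mDP_algebra K l A" "mDP_algebra K l B"
    and CD: "mDP_triple K l A C f g" "mDP_triple K l B D j k"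
  interpret tensor_ptriple K A B C D f g j k
    using AB CD by (intro tensor_ptripleI)
      (simp_all add: mDP_algebra_def mDP_triple_def mdifferential_algebra_def mDL_algebra_def)
  let ?P = "mDP_tensor K l A B" and ?Q = "mdiff_tensor K l C D"
  note P = diff_tensor_simps(8,10)[of K l A B] and Q = diff_tensor_simps(3)[of K l C D]
  note simps = AB.tensor_algebra_simps[OF P(1)] CD.tensor_algebra_simps[OF Q] diff_tensor_simps(4,9)
  have ders: "der A \<in> linear_maps K A A" "der B \<in> linear_maps K B B"
    "der C \<in> linear_maps K C C" "der D \<in> linear_maps K D D"
    and comms: "commutes_with_der A C f" "commutes_with_der A C g"
      "commutes_with_der B D j" "commutes_with_der B D k"
    using AB CD by (simp_all add: mDP_algebra_def mDP_triple_def mdifferential_algebra_def ptriple_lie_def)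
  note map_der = tensor_map_mder[OF modules \<open>l \<in> carrier K\<close> ders]
  note lin = tensor_mder_linear[OF modules(3,4) \<open>l \<in> carrier K\<close> ders(3,4)]
  have "commutes_with_der ?P ?Q F"
    using map_der[OF linear(1) comms(1) linear(3) comms(3)]
    by (simp add: commutes_with_der_def simps F_def)
  moreover have "commutes_with_der ?P ?Q G"
    using map_der[OF linear(1) comms(1) linear(4) comms(4)]
      map_der[OF linear(2) comms(2) linear(3) comms(3)] linear_maps_add[OF lin]
      linear_maps_closed[OF tensor_map_linear[OF modules linear(1,4)]]
      linear_maps_closed[OF tensor_map_linear[OF modules linear(2,3)]]
    by (simp add: commutes_with_der_def simps G_def)
  moreover have "mdifferential_algebra K l ?Q"
    using CD \<open>l \<in> carrier K\<close> by (simp add: mDP_triple_def mdifferential_algebra_tensor)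
  moreover have "tensor_map K C D f j = F"
    "(\<lambda>x. tensor_map K C D f k x \<oplus>\<^bsub>?Q\<^esub> tensor_map K C D g j x) = G"
    by (simp_all add: F_def G_def fun_eq_iff simps)
  ultimately show "mDP_triple K l ?P ?Q (tensor_map K C D f j)
      (\<lambda>x. tensor_map K C D f k x \<oplus>\<^bsub>?Q\<^esub> tensor_map K C D g j x)"
    using ptriple[OF P Q] by (simp add: mDP_triple_def ptriple_lie_def)
qed

end
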